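(* Let $(M,\nabla)$ be an affine manifold (i.e. $\nabla$ is a torsion-free connection on $TM$ with vanishing curvature) and let $h$ be a symmetric bivector field on $M$. Define, for $\alpha,\beta\in\Omega^1(M)$ and $X\in\Gamma(TM)$, $$[\alpha,\beta]_h:=\nabla_{h_\#(\alpha)}\beta-\nabla_{h_\#(\beta)}\alpha,\qquad \langle \mathcal{D}_\alpha\beta,X\rangle:=(\nabla_Xh)(\alpha,\beta)+\langle\nabla_{h_\#(\alpha)}\beta,X\rangle .$$ Then the following assertions are equivalent: (i) $h$ is a pseudo-Hessian bivector field, i.e. $(\nabla_{h_\#(\alpha)}h)(\beta,\gamma)=(\nabla_{h_\#(\beta)}h)(\alpha,\gamma)$ for all $\alpha,\beta,\gamma\in\Omega^1(M)$. (ii) $(T^*M,h_\#,[\;,\;]_h)$ is a Lie algebroid (with anchor $h_\#$ and bracket $[\;,\;]_h$). In this case, $\mathcal{D}$ is a connection for the Lie algebroid structure $(T^*M,h_\#,[\;,\;]_h)$ satisfying, for all $\alpha,\beta\in\Omega^1(M)$, $$h_\#(\mathcal{D}_\alpha\beta)=\nabla_{h_\#(\alpha)}h_\#(\beta)\quad\text{and}\quad R_{\mathcal{D}}(\alpha,\beta):=\mathcal{D}_{[\alpha,\beta]_h}-\mathcal{D}_\alpha\mathcal{D}_\beta+\mathcal{D}_\beta\mathcal{D}_\alpha=0.$$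
   Context: A symmetric bivector field $h$ is a smooth section of the symmetric square of $TM$, viewed as a symmetric bilinear form on $T^*M$; $h_\#:T^*M\to TM$ is defined by $\beta(h_\#(\alpha))=h(\alpha,\beta)$. The connection $\nabla$ is extended to all tensor fields as usual. A connection for a Lie algebroid structure on $T^*M$ with anchor $h_\#$ means an $\mathbb{R}$-bilinear map $\mathcal{D}:\Omega^1(M)\times\Omega^1(M)\to\Omega^1(M)$ with $\mathcal{D}_{f\alpha}\beta=f\mathcal{D}_\alpha\beta$ and $\mathcal{D}_\alpha(f\beta)=f\mathcal{D}_\alpha\beta+h_\#(\alpha)(f)\beta$ for all $f\in C^\infty(M)$. *)

theory Defs
  imports "HOL-Analysis.Analysis" "HOL-Library.Function_Algebras"
begin

text \<open>Sections are functions on the manifold, tangent vectors are functionals on smooth functions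
  and covectors are functionals on tangent vectors. All of these are made to vanish outside their
  intended domain, so the pointwise operations \<open>+\<close>, \<open>-\<close>, \<open>0\<close> on functions are the vector space
  operations, and equality of sections is plain equality.\<close>

section \<open>Smooth manifolds\<close>

text \<open>The set \<open>S\<close> is always open below, so \<open>frechet_derivative f (at x)\<close> is the total derivative.
  Since the domain is finite dimensional, continuity of all the directional derivatives of a
  differentiable function is continuity of its total derivative.\<close>

fun Ck_on :: "nat \<Rightarrow> 'e::euclidean_space set \<Rightarrow> ('e \<Rightarrow> 'f::real_normed_vector) \<Rightarrow> bool" where
  "Ck_on 0 S f \<longleftrightarrow> continuous_on S f"
| "Ck_on (Suc k) S f \<longleftrightarrow> (\<forall>x\<in>S. f differentiable (at x)) \<and>
     (\<forall>v. Ck_on k S (\<lambda>x. frechet_derivative f (at x) v))"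

definition smooth_on :: "'e::euclidean_space set \<Rightarrow> ('e \<Rightarrow> 'f::real_normed_vector) \<Rightarrow> bool" where
  "smooth_on S f \<longleftrightarrow> (\<forall>k. Ck_on k S f)"

type_synonym ('a, 'e) chart = "'a set \<times> ('a \<Rightarrow> 'e)"

definition is_chart :: "('a::topological_space, 'e::euclidean_space) chart \<Rightarrow> bool" where
  "is_chart c \<longleftrightarrow> (case c of (U, \<phi>) \<Rightarrow>
     open U \<and> open (\<phi> ` U) \<and> homeomorphism U (\<phi> ` U) \<phi> (inv_into U \<phi>))"

text \<open>The manifold is the whole type \<open>'a\<close>; being Hausdorff and second countable is part of its sort.
  The atlas need not be maximal.\<close>

definition smooth_manifold ::
  "('a::{t2_space, second_countable_topology}, 'e::euclidean_space) chart set \<Rightarrow> bool" where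
  "smooth_manifold A \<longleftrightarrow>
     (\<forall>c\<in>A. is_chart c) \<and> (\<Union>c\<in>A. fst c) = UNIV \<and>
     (\<forall>(U, \<phi>)\<in>A. \<forall>(V, \<psi>)\<in>A. smooth_on (\<phi> ` (U \<inter> V)) (\<psi> \<circ> inv_into U \<phi>))"

definition smooth_funs :: "('a, 'e::euclidean_space) chart set \<Rightarrow> ('a \<Rightarrow> real) set" where
  "smooth_funs A = {f. \<forall>(U, \<phi>)\<in>A. smooth_on (\<phi> ` U) (f \<circ> inv_into U \<phi>)}"

section \<open>Vector fields and one-forms\<close>

type_synonym 'a tvec = "('a \<Rightarrow> real) \<Rightarrow> real"
type_synonym 'a covec = "'a tvec \<Rightarrow> real"
type_synonym 'a vfield = "'a \<Rightarrow> 'a tvec"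
type_synonym 'a form = "'a \<Rightarrow> 'a covec"
type_synonym 'a bivector = "'a \<Rightarrow> 'a covec \<Rightarrow> 'a covec \<Rightarrow> real"

text \<open>Multiplication of a section by a function, for vector fields and one-forms alike.\<close>

definition fmul :: "('a \<Rightarrow> real) \<Rightarrow> ('a \<Rightarrow> 't \<Rightarrow> real) \<Rightarrow> 'a \<Rightarrow> 't \<Rightarrow> real" (infixr \<open>\<odot>\<close> 75) where
  "f \<odot> s = (\<lambda>p t. f p * s p t)"

text \<open>Tangent vectors at \<open>p\<close> are the derivations at \<open>p\<close> of the algebra of smooth functions.\<close>

definition tangent_space :: "('a, 'e::euclidean_space) chart set \<Rightarrow> 'a \<Rightarrow> 'a tvec set" where
  "tangent_space A p = {v.
     (\<forall>f\<in>smooth_funs A. \<forall>g\<in>smooth_funs A. v (f + g) = v f + v g) \<and>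
     (\<forall>c. \<forall>f\<in>smooth_funs A. v (\<lambda>x. c * f x) = c * v f) \<and>
     (\<forall>f\<in>smooth_funs A. \<forall>g\<in>smooth_funs A. v (f * g) = f p * v g + g p * v f) \<and>
     (\<forall>f. f \<notin> smooth_funs A \<longrightarrow> v f = 0)}"

definition cotangent_space :: "('a, 'e::euclidean_space) chart set \<Rightarrow> 'a \<Rightarrow> 'a covec set" where
  "cotangent_space A p = {\<omega>.
     (\<forall>v\<in>tangent_space A p. \<forall>w\<in>tangent_space A p. \<omega> (v + w) = \<omega> v + \<omega> w) \<and>
     (\<forall>c. \<forall>v\<in>tangent_space A p. \<omega> (\<lambda>f. c * v f) = c * \<omega> v) \<and>
     (\<forall>v. v \<notin> tangent_space A p \<longrightarrow> \<omega> v = 0)}"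

text \<open>\<open>X(f)\<close>, \<open>\<langle>\<alpha>, X\<rangle>\<close> and \<open>h(\<alpha>, \<beta>)\<close> as functions on the manifold.\<close>

definition act :: "'a vfield \<Rightarrow> ('a \<Rightarrow> real) \<Rightarrow> 'a \<Rightarrow> real" where
  "act X f = (\<lambda>p. X p f)"

definition pair :: "'a form \<Rightarrow> 'a vfield \<Rightarrow> 'a \<Rightarrow> real" where
  "pair \<alpha> X = (\<lambda>p. \<alpha> p (X p))"

definition biv :: "'a bivector \<Rightarrow> 'a form \<Rightarrow> 'a form \<Rightarrow> 'a \<Rightarrow> real" where
  "biv h \<alpha> \<beta> = (\<lambda>p. h p (\<alpha> p) (\<beta> p))"

text \<open>Smoothness of a section is tested by letting it act on smooth arguments, which is the same as
  smoothness of its components in every chart.\<close>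

definition vector_fields :: "('a, 'e::euclidean_space) chart set \<Rightarrow> 'a vfield set" where
  "vector_fields A = {X. (\<forall>p. X p \<in> tangent_space A p) \<and>
     (\<forall>f\<in>smooth_funs A. act X f \<in> smooth_funs A)}"

definition one_forms :: "('a, 'e::euclidean_space) chart set \<Rightarrow> 'a form set" where
  "one_forms A = {\<alpha>. (\<forall>p. \<alpha> p \<in> cotangent_space A p) \<and>
     (\<forall>X\<in>vector_fields A. pair \<alpha> X \<in> smooth_funs A)}"

text \<open>The Lie bracket of vector fields, \<open>[X, Y](f) = X(Y(f)) - Y(X(f))\<close>.\<close>

definition lie :: "'a vfield \<Rightarrow> 'a vfield \<Rightarrow> 'a vfield" where
  "lie X Y = (\<lambda>p f. act X (act Y f) p - act Y (act X f) p)"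

text \<open>The one-form with prescribed values on vector fields; it exists and is unique whenever the
  prescription \<open>L\<close> is linear over the smooth functions.\<close>

definition form_of :: "('a, 'e::euclidean_space) chart set \<Rightarrow> ('a vfield \<Rightarrow> 'a \<Rightarrow> real) \<Rightarrow> 'a form" where
  "form_of A L = (THE \<gamma>. \<gamma> \<in> one_forms A \<and> (\<forall>X\<in>vector_fields A. pair \<gamma> X = L X))"

section \<open>Symmetric bivector fields\<close>

definition sym_square :: "('a, 'e::euclidean_space) chart set \<Rightarrow> 'a \<Rightarrow> ('a covec \<Rightarrow> 'a covec \<Rightarrow> real) set" where
  "sym_square A p = {H.
     (\<forall>\<alpha>\<in>cotangent_space A p. \<forall>\<beta>\<in>cotangent_space A p. H \<alpha> \<beta> = H \<beta> \<alpha>) \<and>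
     (\<forall>\<alpha>\<in>cotangent_space A p. \<forall>\<beta>\<in>cotangent_space A p. \<forall>\<gamma>\<in>cotangent_space A p.
        H (\<alpha> + \<beta>) \<gamma> = H \<alpha> \<gamma> + H \<beta> \<gamma>) \<and>
     (\<forall>c. \<forall>\<alpha>\<in>cotangent_space A p. \<forall>\<beta>\<in>cotangent_space A p.
        H (\<lambda>v. c * \<alpha> v) \<beta> = c * H \<alpha> \<beta>) \<and>
     (\<forall>\<alpha> \<beta>. \<alpha> \<notin> cotangent_space A p \<or> \<beta> \<notin> cotangent_space A p \<longrightarrow> H \<alpha> \<beta> = 0)}"

definition symmetric_bivector_fields :: "('a, 'e::euclidean_space) chart set \<Rightarrow> 'a bivector set" where
  "symmetric_bivector_fields A = {h. (\<forall>p. h p \<in> sym_square A p) \<and>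
     (\<forall>\<alpha>\<in>one_forms A. \<forall>\<beta>\<in>one_forms A. biv h \<alpha> \<beta> \<in> smooth_funs A)}"

text \<open>The bundle map \<open>h\<^sub>#\<close>, fibre by fibre: \<open>\<beta>(h\<^sub>#(\<alpha>)) = h(\<alpha>, \<beta>)\<close>.\<close>

definition sharp :: "('a, 'e::euclidean_space) chart set \<Rightarrow> 'a bivector \<Rightarrow> 'a \<Rightarrow> 'a covec \<Rightarrow> 'a tvec" where
  "sharp A h p \<alpha> = (THE v. v \<in> tangent_space A p \<and> (\<forall>\<beta>\<in>cotangent_space A p. \<beta> v = h p \<alpha> \<beta>))"

text \<open>A bundle map from the cotangent to the tangent bundle, applied to a section.\<close>

definition on_sections :: "('a \<Rightarrow> 'a covec \<Rightarrow> 'a tvec) \<Rightarrow> 'a form \<Rightarrow> 'a vfield" where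
  "on_sections \<rho> \<alpha> = (\<lambda>p. \<rho> p (\<alpha> p))"

section \<open>Affine manifolds\<close>

definition real_bilinear_map ::
  "('a \<Rightarrow> 's \<Rightarrow> real) set \<Rightarrow> ('a \<Rightarrow> 't \<Rightarrow> real) set \<Rightarrow>
   (('a \<Rightarrow> 's \<Rightarrow> real) \<Rightarrow> ('a \<Rightarrow> 't \<Rightarrow> real) \<Rightarrow> ('a \<Rightarrow> 't \<Rightarrow> real)) \<Rightarrow> bool" where
  "real_bilinear_map S T F \<longleftrightarrow>
     (\<forall>s\<in>S. \<forall>t\<in>T. F s t \<in> T) \<and>
     (\<forall>s\<in>S. \<forall>s'\<in>S. \<forall>t\<in>T. F (s + s') t = F s t + F s' t) \<and>
     (\<forall>s\<in>S. \<forall>t\<in>T. \<forall>t'\<in>T. F s (t + t') = F s t + F s t') \<and>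
     (\<forall>c. \<forall>s\<in>S. \<forall>t\<in>T. F ((\<lambda>_. c) \<odot> s) t = (\<lambda>_. c) \<odot> F s t) \<and>
     (\<forall>c. \<forall>s\<in>S. \<forall>t\<in>T. F s ((\<lambda>_. c) \<odot> t) = (\<lambda>_. c) \<odot> F s t)"

definition is_connection ::
  "('a, 'e::euclidean_space) chart set \<Rightarrow> ('a vfield \<Rightarrow> 'a vfield \<Rightarrow> 'a vfield) \<Rightarrow> bool" where
  "is_connection A nabla \<longleftrightarrow>
     real_bilinear_map (vector_fields A) (vector_fields A) nabla \<and>
     (\<forall>f\<in>smooth_funs A. \<forall>X\<in>vector_fields A. \<forall>Y\<in>vector_fields A.
        nabla (f \<odot> X) Y = f \<odot> nabla X Y \<and>
        nabla X (f \<odot> Y) = f \<odot> nabla X Y + act X f \<odot> Y)"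

definition affine_manifold ::
  "('a::{t2_space, second_countable_topology}, 'e::euclidean_space) chart set \<Rightarrow>
   ('a vfield \<Rightarrow> 'a vfield \<Rightarrow> 'a vfield) \<Rightarrow> bool" where
  "affine_manifold A nabla \<longleftrightarrow>
     smooth_manifold A \<and> is_connection A nabla \<and>
     (\<forall>X\<in>vector_fields A. \<forall>Y\<in>vector_fields A. nabla X Y - nabla Y X = lie X Y) \<and>
     (\<forall>X\<in>vector_fields A. \<forall>Y\<in>vector_fields A. \<forall>Z\<in>vector_fields A.
        nabla (lie X Y) Z - (nabla X (nabla Y Z) - nabla Y (nabla X Z)) = 0)"

text \<open>The extension of the connection to one-forms and to bivector fields by the Leibniz rule:
  \<open>\<langle>\<nabla>\<^sub>X \<beta>, Y\<rangle> = X\<langle>\<beta>, Y\<rangle> - \<langle>\<beta>, \<nabla>\<^sub>X Y\<rangle>\<close> and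
  \<open>(\<nabla>\<^sub>X h)(\<alpha>, \<beta>) = X(h(\<alpha>, \<beta>)) - h(\<nabla>\<^sub>X \<alpha>, \<beta>) - h(\<alpha>, \<nabla>\<^sub>X \<beta>)\<close>.\<close>

definition cov_form ::
  "('a, 'e::euclidean_space) chart set \<Rightarrow> ('a vfield \<Rightarrow> 'a vfield \<Rightarrow> 'a vfield) \<Rightarrow>
   'a vfield \<Rightarrow> 'a form \<Rightarrow> 'a form" where
  "cov_form A nabla X \<beta> = form_of A (\<lambda>Y. act X (pair \<beta> Y) - pair \<beta> (nabla X Y))"

definition cov_biv ::
  "('a, 'e::euclidean_space) chart set \<Rightarrow> ('a vfield \<Rightarrow> 'a vfield \<Rightarrow> 'a vfield) \<Rightarrow>
   'a vfield \<Rightarrow> 'a bivector \<Rightarrow> 'a form \<Rightarrow> 'a form \<Rightarrow> 'a \<Rightarrow> real" where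
  "cov_biv A nabla X h \<alpha> \<beta> =
     act X (biv h \<alpha> \<beta>) - biv h (cov_form A nabla X \<alpha>) \<beta> - biv h \<alpha> (cov_form A nabla X \<beta>)"

definition pseudo_Hessian ::
  "('a, 'e::euclidean_space) chart set \<Rightarrow> ('a vfield \<Rightarrow> 'a vfield \<Rightarrow> 'a vfield) \<Rightarrow> 'a bivector \<Rightarrow> bool" where
  "pseudo_Hessian A nabla h \<longleftrightarrow>
     (\<forall>\<alpha>\<in>one_forms A. \<forall>\<beta>\<in>one_forms A. \<forall>\<gamma>\<in>one_forms A.
        cov_biv A nabla (on_sections (sharp A h) \<alpha>) h \<beta> \<gamma> =
        cov_biv A nabla (on_sections (sharp A h) \<beta>) h \<alpha> \<gamma>)"

section \<open>Lie algebroid structures on the cotangent bundle\<close>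

text \<open>That the anchor is a homomorphism of Lie algebras is a consequence of these axioms.\<close>

definition is_bundle_map ::
  "('a, 'e::euclidean_space) chart set \<Rightarrow> ('a \<Rightarrow> 'a covec \<Rightarrow> 'a tvec) \<Rightarrow> bool" where
  "is_bundle_map A \<rho> \<longleftrightarrow>
     (\<forall>p. \<forall>\<alpha>\<in>cotangent_space A p. \<rho> p \<alpha> \<in> tangent_space A p) \<and>
     (\<forall>p. \<forall>\<alpha>\<in>cotangent_space A p. \<forall>\<beta>\<in>cotangent_space A p. \<rho> p (\<alpha> + \<beta>) = \<rho> p \<alpha> + \<rho> p \<beta>) \<and>
     (\<forall>p c. \<forall>\<alpha>\<in>cotangent_space A p. \<rho> p (\<lambda>v. c * \<alpha> v) = (\<lambda>f. c * \<rho> p \<alpha> f)) \<and>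
     (\<forall>\<alpha>\<in>one_forms A. on_sections \<rho> \<alpha> \<in> vector_fields A)"

definition is_cotangent_Lie_algebroid ::
  "('a, 'e::euclidean_space) chart set \<Rightarrow> ('a \<Rightarrow> 'a covec \<Rightarrow> 'a tvec) \<Rightarrow>
   ('a form \<Rightarrow> 'a form \<Rightarrow> 'a form) \<Rightarrow> bool" where
  "is_cotangent_Lie_algebroid A \<rho> br \<longleftrightarrow>
     is_bundle_map A \<rho> \<and>
     real_bilinear_map (one_forms A) (one_forms A) br \<and>
     (\<forall>\<alpha>\<in>one_forms A. \<forall>\<beta>\<in>one_forms A. br \<alpha> \<beta> = - br \<beta> \<alpha>) \<and>
     (\<forall>\<alpha>\<in>one_forms A. \<forall>\<beta>\<in>one_forms A. \<forall>\<gamma>\<in>one_forms A.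
        br \<alpha> (br \<beta> \<gamma>) + br \<beta> (br \<gamma> \<alpha>) + br \<gamma> (br \<alpha> \<beta>) = 0) \<and>
     (\<forall>f\<in>smooth_funs A. \<forall>\<alpha>\<in>one_forms A. \<forall>\<beta>\<in>one_forms A.
        br \<alpha> (f \<odot> \<beta>) = f \<odot> br \<alpha> \<beta> + act (on_sections \<rho> \<alpha>) f \<odot> \<beta>)"

definition is_algebroid_connection ::
  "('a, 'e::euclidean_space) chart set \<Rightarrow> ('a \<Rightarrow> 'a covec \<Rightarrow> 'a tvec) \<Rightarrow>
   ('a form \<Rightarrow> 'a form \<Rightarrow> 'a form) \<Rightarrow> bool" where
  "is_algebroid_connection A \<rho> D \<longleftrightarrow>
     real_bilinear_map (one_forms A) (one_forms A) D \<and>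
     (\<forall>f\<in>smooth_funs A. \<forall>\<alpha>\<in>one_forms A. \<forall>\<beta>\<in>one_forms A.
        D (f \<odot> \<alpha>) \<beta> = f \<odot> D \<alpha> \<beta> \<and>
        D \<alpha> (f \<odot> \<beta>) = f \<odot> D \<alpha> \<beta> + act (on_sections \<rho> \<alpha>) f \<odot> \<beta>)"

definition h_bracket ::
  "('a, 'e::euclidean_space) chart set \<Rightarrow> ('a vfield \<Rightarrow> 'a vfield \<Rightarrow> 'a vfield) \<Rightarrow> 'a bivector \<Rightarrow>
   'a form \<Rightarrow> 'a form \<Rightarrow> 'a form" where
  "h_bracket A nabla h \<alpha> \<beta> =
     cov_form A nabla (on_sections (sharp A h) \<alpha>) \<beta> - cov_form A nabla (on_sections (sharp A h) \<beta>) \<alpha>"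

definition h_connection ::
  "('a, 'e::euclidean_space) chart set \<Rightarrow> ('a vfield \<Rightarrow> 'a vfield \<Rightarrow> 'a vfield) \<Rightarrow> 'a bivector \<Rightarrow>
   'a form \<Rightarrow> 'a form \<Rightarrow> 'a form" where
  "h_connection A nabla h \<alpha> \<beta> =
     form_of A (\<lambda>X. cov_biv A nabla X h \<alpha> \<beta> + pair (cov_form A nabla (on_sections (sharp A h) \<alpha>) \<beta>) X)"

definition algebroid_curvature ::
  "('a form \<Rightarrow> 'a form \<Rightarrow> 'a form) \<Rightarrow> ('a form \<Rightarrow> 'a form \<Rightarrow> 'a form) \<Rightarrow>
   'a form \<Rightarrow> 'a form \<Rightarrow> 'a form \<Rightarrow> 'a form" where
  "algebroid_curvature br D \<alpha> \<beta> \<gamma> = D (br \<alpha> \<beta>) \<gamma> - D \<alpha> (D \<beta> \<gamma>) + D \<beta> (D \<alpha> \<gamma>)"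

end

theory Submission
  imports Defs
begin

text \<open>Write \<open>\<sharp>\<close> for the anchor and \<open>Z(\<alpha>, \<beta>) = [\<sharp>\<alpha>, \<sharp>\<beta>] - \<sharp>[\<alpha>, \<beta>]\<close>. Vanishing torsion gives
  \<open>\<langle>\<gamma>, Z(\<alpha>, \<beta>)\<rangle> = (\<nabla>\<^bsub>\<sharp>\<alpha>\<^esub> h)(\<beta>, \<gamma>) - (\<nabla>\<^bsub>\<sharp>\<beta>\<^esub> h)(\<alpha>, \<gamma>)\<close>, so \<open>h\<close> is pseudo-Hessian iff \<open>Z = 0\<close>, while
  flatness turns the Jacobiator of \<open>\<alpha>, \<beta>, \<gamma>\<close> into the cyclic sum of \<open>\<nabla>\<^bsub>Z(\<alpha>, \<beta>)\<^esub> \<gamma>\<close>. Hence \<open>Z = 0\<close>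
  implies the Jacobi identity; conversely, replacing \<open>\<gamma>\<close> by \<open>f \<gamma>\<close> produces the extra term
  \<open>Z(\<alpha>, \<beta>)(f) \<gamma>\<close>, which must vanish for all \<open>f\<close> and \<open>\<gamma>\<close>.

  For the curvature, \<open>\<langle>\<D>\<^bsub>\<alpha>\<^esub> \<beta>, X\<rangle> = \<sharp>\<alpha>(\<langle>\<beta>, X\<rangle>) - \<langle>\<beta>, [\<sharp>\<alpha>, X]\<rangle> - \<langle>\<nabla>\<^bsub>X\<^esub> \<alpha>, \<sharp>\<beta>\<rangle>\<close>, a formula that can be iterated
  without parallel frames because \<open>\<sharp>\<D>\<^bsub>\<alpha>\<^esub> \<beta> = \<nabla>\<^bsub>\<sharp>\<alpha>\<^esub> \<sharp>\<beta>\<close>.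

  That tensors are pointwise objects, even though tangent vectors are abstract derivations, rests on
  one fact: near every point there are global functions \<open>x\<^sub>i\<close>, global vector fields \<open>E\<^sub>i\<close> and a cutoff
  \<open>\<zeta>\<close> with \<open>\<zeta> v = \<Sum>\<^sub>i v(x\<^sub>i) E\<^sub>i\<close> for every tangent vector \<open>v\<close> of the manifold.\<close>

section \<open>Smooth functions on open sets\<close>

lemma Ck_on_cong:
  assumes "open S" "\<And>x. x \<in> S \<Longrightarrow> f x = g x" "Ck_on k S f"
  shows "Ck_on k S g"
  using assms(2,3)
proof (induction k arbitrary: f g)
  case 0
  then show ?case by (auto cong: continuous_on_cong)
next
  case (Suc k)
  have D: "(g has_derivative frechet_derivative f (at x)) (at x)" if "x \<in> S" for x
    using has_derivative_transform_within_open[OF _ assms(1) that, of f _ UNIV g] Suc.prems that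
    by (simp add: frechet_derivative_works)
  have eq: "frechet_derivative f (at x) = frechet_derivative g (at x)" if "x \<in> S" for x
    using frechet_derivative_at[OF D[OF that]] .
  have "Ck_on k S (\<lambda>x. frechet_derivative g (at x) v)" for v
    by (rule Suc.IH[of "\<lambda>x. frechet_derivative f (at x) v"]) (use Suc.prems eq in auto)
  then show ?case using D by (auto simp: differentiable_def)
qed

text \<open>Any derivative \<open>f'\<close> known on \<open>S\<close> may stand in for
  \<open>frechet_derivative\<close>: derivatives are unique, and \<open>Ck_on_cong\<close> transfers
  the lower-order condition. The closure inductions can thus use the usual differentiation
  rules.\<close>

lemma Ck_on_SucI:
  assumes "open S" "\<And>x. x \<in> S \<Longrightarrow> (f has_derivative f' x) (at x)"
    and "\<And>v. Ck_on k S (\<lambda>x. f' x v)"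
  shows "Ck_on (Suc k) S f"
proof -
  have "frechet_derivative f (at x) = f' x" if "x \<in> S" for x
    using frechet_derivative_at[OF assms(2)[OF that]] by simp
  then have "Ck_on k S (\<lambda>x. frechet_derivative f (at x) v)" for v
    by (intro Ck_on_cong[OF assms(1) _ assms(3)[of v]]) auto
  then show ?thesis using assms(2) by (auto simp: differentiable_def)
qed

lemma Ck_on_SucD:
  assumes "Ck_on (Suc k) S f"
  shows "\<And>x. x \<in> S \<Longrightarrow> (f has_derivative frechet_derivative f (at x)) (at x)"
    and "\<And>v. Ck_on k S (\<lambda>x. frechet_derivative f (at x) v)"
  using assms by (auto simp: frechet_derivative_works)

lemma Ck_on_Suc_imp: "Ck_on (Suc k) S f \<Longrightarrow> Ck_on k S f"
proof (induction k arbitrary: f)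
  case 0
  then show ?case
    by (auto intro!: differentiable_imp_continuous_on simp: differentiable_on_def differentiable_at_withinI)
next
  case (Suc k)
  show ?case
    unfolding Ck_on.simps
    using Suc.prems Suc.IH[OF Ck_on_SucD(2)[OF Suc.prems]] by simp
qed

lemma Ck_on_subset: "Ck_on k S f \<Longrightarrow> T \<subseteq> S \<Longrightarrow> Ck_on k T f"
  by (induction k arbitrary: f) (auto intro: continuous_on_subset)

text \<open>Differentiability is a condition point by point, so openness enters only in the base
  case, where continuity is glued. The lemma serves extensions by zero.\<close>

lemma Ck_on_Un:
  assumes "open S" "open T" "Ck_on k S f" "Ck_on k T f"
  shows "Ck_on k (S \<union> T) f"
  using assms(3,4)
  by (induction k arbitrary: f) (auto intro: continuous_on_open_Un assms(1,2))

lemma Ck_on_const: "open S \<Longrightarrow> Ck_on k S (\<lambda>_. c)"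
proof (induction k arbitrary: c)
  case (Suc k)
  show ?case by (rule Ck_on_SucI[where f'="\<lambda>_ _. 0"]) (auto intro: Suc derivative_eq_intros)
qed auto

lemma Ck_on_add:
  assumes "open S" "Ck_on k S f" "Ck_on k S g"
  shows "Ck_on k S (\<lambda>x. f x + g x)"
  using assms(2,3)
proof (induction k arbitrary: f g)
  case (Suc k)
  note D = Ck_on_SucD[OF Suc.prems(1)] Ck_on_SucD[OF Suc.prems(2)]
  show ?case
    by (rule Ck_on_SucI[OF assms(1) has_derivative_add[OF D(1) D(3)] Suc.IH[OF D(2) D(4)]])
qed (auto intro: continuous_intros)

lemma Ck_on_sum:
  assumes "open S" "\<And>i. i \<in> I \<Longrightarrow> Ck_on k S (f i)"
  shows "Ck_on k S (\<lambda>x. \<Sum>i\<in>I. f i x)"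
  using assms(2)
  by (induction I rule: infinite_finite_induct) (auto intro: Ck_on_const Ck_on_add assms(1))

lemma Ck_on_mult:
  fixes f g :: "'e::euclidean_space \<Rightarrow> real"
  assumes "open S" "Ck_on k S f" "Ck_on k S g"
  shows "Ck_on k S (\<lambda>x. f x * g x)"
  using assms(2,3)
proof (induction k arbitrary: f g)
  case (Suc k)
  note D = Ck_on_SucD[OF Suc.prems(1)] Ck_on_SucD[OF Suc.prems(2)]
  \<comment> \<open>Each Leibniz term pairs an undifferentiated factor with a derivative of order
    \<open>k\<close>, so the former is lowered from order \<open>Suc k\<close> to
    \<open>k\<close>.\<close>
  note S = Suc.prems[THEN Ck_on_Suc_imp]
  show ?case
    by (rule Ck_on_SucI[OF assms(1) has_derivative_mult[OF D(1) D(3)]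
        Ck_on_add[OF assms(1) Suc.IH[OF S(1) D(4)] Suc.IH[OF D(2) S(2)]]])
qed (auto intro: continuous_intros)

lemma Ck_on_bounded_linear:
  assumes "open S" "bounded_linear L" "Ck_on k S f"
  shows "Ck_on k S (\<lambda>x. L (f x))"
  using assms(3)
proof (induction k arbitrary: f)
  case 0
  then show ?case using bounded_linear.continuous_on[OF assms(2)] by simp
next
  case (Suc k)
  note D = Ck_on_SucD[OF Suc.prems]
  show ?case
    by (rule Ck_on_SucI[OF assms(1) bounded_linear.has_derivative[OF assms(2) D(1)] Suc.IH[OF D(2)]])
qed

lemma smooth_onD: "smooth_on S f \<Longrightarrow> x \<in> S \<Longrightarrow> (f has_derivative frechet_derivative f (at x)) (at x)"
  unfolding smooth_on_def by (rule Ck_on_SucD(1)[of 0]) auto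

lemma smooth_on_frechet: "smooth_on S f \<Longrightarrow> smooth_on S (\<lambda>x. frechet_derivative f (at x) v)"
  unfolding smooth_on_def by (intro allI Ck_on_SucD(2)) blast

lemma smooth_on_continuous: "smooth_on S f \<Longrightarrow> continuous_on S f"
  unfolding smooth_on_def by (metis Ck_on.simps(1))

lemma smooth_on_cong:
  assumes "open S" "\<And>x. x \<in> S \<Longrightarrow> f x = g x" "smooth_on S f"
  shows "smooth_on S g"
  using assms(3) Ck_on_cong[OF assms(1,2)] unfolding smooth_on_def by simp

lemma smooth_on_subset: "smooth_on S f \<Longrightarrow> T \<subseteq> S \<Longrightarrow> smooth_on T f"
  unfolding smooth_on_def by (auto intro: Ck_on_subset)

lemma smooth_on_Un: "open S \<Longrightarrow> open T \<Longrightarrow> smooth_on S f \<Longrightarrow> smooth_on T f \<Longrightarrow> smooth_on (S \<union> T) f"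
  unfolding smooth_on_def by (auto intro: Ck_on_Un)

lemma smooth_on_const: "open S \<Longrightarrow> smooth_on S (\<lambda>_. c)"
  unfolding smooth_on_def by (auto intro: Ck_on_const)

lemma smooth_on_add: "open S \<Longrightarrow> smooth_on S f \<Longrightarrow> smooth_on S g \<Longrightarrow> smooth_on S (\<lambda>x. f x + g x)"
  unfolding smooth_on_def by (auto intro: Ck_on_add)

lemma smooth_on_mult:
  fixes f g :: "'e::euclidean_space \<Rightarrow> real"
  shows "open S \<Longrightarrow> smooth_on S f \<Longrightarrow> smooth_on S g \<Longrightarrow> smooth_on S (\<lambda>x. f x * g x)"
  unfolding smooth_on_def by (auto intro: Ck_on_mult)

lemma smooth_on_linear:
  assumes "open S" "bounded_linear L"
  shows "smooth_on S L"
  unfolding smooth_on_def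
proof
  fix k show "Ck_on k S L"
  proof (cases k)
    case 0
    then show ?thesis using linear_continuous_on assms(2) by auto
  next
    case (Suc m)
    have "Ck_on (Suc m) S L"
      by (rule Ck_on_SucI[OF assms(1) bounded_linear_imp_has_derivative[OF assms(2)] Ck_on_const[OF assms(1)]])
    with Suc show ?thesis by simp
  qed
qed

text \<open>Induction on the order with \<open>T\<close> fixed and \<open>F\<close> arbitrary. In
  coordinates the chain rule gives a finite sum of products of a partial derivative of
  \<open>F\<close>, composed with \<open>T\<close>, and a component of the derivative of
  \<open>T\<close>. These partial derivatives are smooth again, so the induction hypothesis applies
  to them.\<close>

lemma smooth_on_compose:
  fixes F :: "'f::euclidean_space \<Rightarrow> real" and T :: "'e::euclidean_space \<Rightarrow> 'f"
  assumes S: "open S" and F: "smooth_on R F" and T: "smooth_on S T" and TS: "T ` S \<subseteq> R"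
  shows "smooth_on S (\<lambda>x. F (T x))"
proof -
  have "Ck_on k S (\<lambda>x. F (T x))" for k
    using F
  proof (induction k arbitrary: F)
    case 0
    then show ?case
      using continuous_on_compose2[OF smooth_on_continuous smooth_on_continuous[OF T] TS] by simp
  next
    case (Suc k)
    have D: "((\<lambda>x. F (T x)) has_derivative (\<lambda>v. \<Sum>b\<in>Basis.
        frechet_derivative F (at (T x)) b * (frechet_derivative T (at x) v \<bullet> b))) (at x)" if "x \<in> S" for x
    proof -
      have F': "(F has_derivative frechet_derivative F (at (T x))) (at (T x))"
        using smooth_onD[OF Suc.prems] that TS by auto
      then have lin: "linear (frechet_derivative F (at (T x)))"
        by (simp add: has_derivative_linear)
      have eq: "frechet_derivative F (at (T x)) w = (\<Sum>b\<in>Basis. frechet_derivative F (at (T x)) b * (w \<bullet> b))" for w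
        using arg_cong[OF euclidean_representation[of w], of "frechet_derivative F (at (T x))"]
        by (simp add: linear_sum[OF lin] linear_cmul[OF lin] mult.commute)
      show ?thesis
        by (rule has_derivative_eq_rhs[OF has_derivative_compose[OF smooth_onD[OF T that] F']])
          (rule ext, rule eq)
    qed
    show ?case
    proof (rule Ck_on_SucI[OF S D], assumption)
      fix v
      have "Ck_on k S (\<lambda>x. frechet_derivative T (at x) v \<bullet> b)" for b
        by (rule Ck_on_bounded_linear[OF S bounded_linear_inner_left])
          (use smooth_on_frechet[OF T] in \<open>auto simp: smooth_on_def\<close>)
      then show "Ck_on k S (\<lambda>x. \<Sum>b\<in>Basis. frechet_derivative F (at (T x)) b *
          (frechet_derivative T (at x) v \<bullet> b))"
        by (intro Ck_on_sum Ck_on_mult S Suc.IH smooth_on_frechet Suc.prems)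
    qed
  qed
  then show ?thesis by (simp add: smooth_on_def)
qed

section \<open>Flat functions and smooth bump functions\<close>

definition flat :: "nat \<Rightarrow> real \<Rightarrow> real" where
  "flat m x = (if x > 0 then (1 / x) ^ m * exp (- (1 / x)) else 0)"

lemma flat_nonpos: "x \<le> 0 \<Longrightarrow> flat m x = 0"
  by (simp add: flat_def)

text \<open>From the right, the substitution y = 1/x reduces the claim to the decay of y^m / exp y
  at infinity.\<close>

lemma tendsto_flat_0: "(flat m \<longlongrightarrow> 0) (at 0)"
proof -
  have "((\<lambda>x::real. inverse x ^ m / exp (inverse x)) \<longlongrightarrow> 0) (at_right 0)"
    by (rule filterlim_compose[OF tendsto_power_div_exp_0 filterlim_inverse_at_top_right])
  then have R: "(flat m \<longlongrightarrow> 0) (at_right 0)"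
    by (rule Lim_transform_eventually)
      (auto simp: eventually_at_filter flat_def exp_minus divide_simps)
  have L: "(flat m \<longlongrightarrow> 0) (at_left 0)"
    by (rule Lim_transform_eventually[OF tendsto_const[of 0]])
      (auto simp: eventually_at_filter flat_def)
  show ?thesis using L R by (simp add: filterlim_split_at)
qed

text \<open>The factors (1/x)^m make the family \<open>flat m\<close> closed under differentiation
  up to linear combinations. At 0 the difference quotient of \<open>flat m\<close> is exactly
  \<open>flat (m + 1)\<close>, which tends to 0.\<close>

lemma flat_deriv: "(flat m has_real_derivative flat (m + 2) x - m * flat (m + 1) x) (at x)"
proof -
  consider "x > 0" | "x < 0" | "x = 0" by linarith
  then show ?thesis
  proof cases
    case 1
    have "((\<lambda>x. (1 / x) ^ m * exp (- (1 / x))) has_real_derivative flat (m + 2) x - m * flat (m + 1) x) (at x)"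
    proof -
      have I: "((\<lambda>x. 1 / x) has_real_derivative - ((1 / x) ^ 2)) (at x)"
        using 1 by (auto intro!: derivative_eq_intros simp: power2_eq_square)
      show ?thesis
        by (rule DERIV_cong[OF DERIV_mult[OF DERIV_power[OF I, of m] DERIV_chain2[OF DERIV_exp DERIV_minus[OF I]]]])
          (use 1 in \<open>cases m; simp add: flat_def power2_eq_square algebra_simps add_divide_distrib\<close>)
    qed
    then show ?thesis
      by (rule has_field_derivative_transform_within_open[where S="{0<..}"]) (use 1 in \<open>auto simp: flat_def\<close>)
  next
    case 2
    have "((\<lambda>x. 0) has_real_derivative flat (m + 2) x - m * flat (m + 1) x) (at x)"
      using 2 by (simp add: flat_def)
    then show ?thesis
      by (rule has_field_derivative_transform_within_open[where S="{..<0}"]) (use 2 in \<open>auto simp: flat_def\<close>)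
  next
    case 3
    have "(\<lambda>y. (flat m (0 + y) - flat m 0) / y) = flat (m + 1)"
      by (auto simp: fun_eq_iff flat_def)
    then show ?thesis using 3 tendsto_flat_0[of "m + 1"] by (simp add: DERIV_def flat_nonpos)
  qed
qed

lemma smooth_on_flat: "smooth_on UNIV (flat m)"
proof -
  have "Ck_on k UNIV (flat m)" for k
  proof (induction k arbitrary: m)
    case 0
    then show ?case
      by (auto intro!: continuous_at_imp_continuous_on DERIV_isCont[OF flat_deriv])
  next
    case (Suc k)
    have "Ck_on k UNIV (\<lambda>x. (flat (m + 2) x + (- real m) * flat (m + 1) x) * v)" for v
      by (intro Ck_on_mult Ck_on_add Ck_on_const Suc open_UNIV)
    then show ?case
      by (intro Ck_on_SucI[where f'="\<lambda>x v. (flat (m + 2) x - m * flat (m + 1) x) * v"]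
          flat_deriv[THEN has_field_derivative_imp_has_derivative]) auto
  qed
  then show ?thesis by (simp add: smooth_on_def)
qed

text \<open>The squared distance makes the argument of \<open>flat 0\<close> a polynomial in the
  coordinates of \<open>y\<close>, so smoothness holds at the centre too.\<close>

definition bump :: "'e::euclidean_space \<Rightarrow> real \<Rightarrow> 'e \<Rightarrow> real" where
  "bump c r y = flat 0 (r\<^sup>2 - (y - c) \<bullet> (y - c))"

lemma smooth_on_sum:
  assumes "open S" "\<And>i. i \<in> I \<Longrightarrow> smooth_on S (f i)"
  shows "smooth_on S (\<lambda>x. \<Sum>i\<in>I. f i x)"
  using assms(2) unfolding smooth_on_def by (auto intro: Ck_on_sum[OF assms(1)])

lemma smooth_on_component: "open S \<Longrightarrow> smooth_on S (\<lambda>y. y \<bullet> b)"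
  by (rule smooth_on_linear) (auto intro: bounded_linear_inner_left)

lemma smooth_on_bump: "smooth_on UNIV (bump c r)"
proof -
  have eq: "bump c r = (\<lambda>y. flat 0 (r\<^sup>2 + (-1) * (\<Sum>b\<in>Basis. (y \<bullet> b + - (c \<bullet> b)) * (y \<bullet> b + - (c \<bullet> b)))))"
    unfolding bump_def
    by (rule ext, subst euclidean_inner) (simp add: inner_diff_left)
  show ?thesis
    unfolding eq
    by (rule smooth_on_compose[OF _ smooth_on_flat])
      (intro smooth_on_add smooth_on_mult smooth_on_sum smooth_on_const smooth_on_component open_UNIV | simp)+
qed

lemma bump_pos:
  assumes "y \<in> ball c r"
  shows "bump c r y > 0"
proof -
  have "(norm (y - c))\<^sup>2 < r\<^sup>2"
    using assms by (intro power_strict_mono) (auto simp: dist_norm norm_minus_commute)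
  then show ?thesis by (simp add: bump_def flat_def dot_square_norm)
qed

lemma bump_zero:
  assumes "r \<ge> 0" "y \<notin> ball c r"
  shows "bump c r y = 0"
proof -
  have "r\<^sup>2 \<le> (norm (y - c))\<^sup>2"
    using assms by (intro power_mono) (auto simp: dist_norm norm_minus_commute)
  then show ?thesis by (simp add: bump_def flat_nonpos dot_square_norm)
qed

section \<open>Differentiation under the integral sign and Hadamard's lemma\<close>

lemma continuous_on_segment:
  fixes S :: "'e::euclidean_space set" and F :: "'e \<Rightarrow> 'f::topological_space"
  assumes "convex S" "q \<in> S" "continuous_on S F"
  shows "continuous_on (S \<times> {0..1::real}) (\<lambda>y. F (q + snd y *\<^sub>R (fst y - q)))"
proof -
  have "q + t *\<^sub>R (x - q) \<in> S" if "x \<in> S" "0 \<le> t" "t \<le> 1" for x t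
    using convexD_alt[OF assms(1,2) that] by (simp add: algebra_simps)
  then show ?thesis
    by (intro continuous_on_compose2[OF assms(3), where f = "\<lambda>y. q + snd y *\<^sub>R (fst y - q)"] continuous_intros) auto
qed

lemma continuous_on_section:
  assumes "continuous_on (S \<times> T) (\<lambda>y. f (fst y) (snd y))" "x \<in> S"
  shows "continuous_on T (f x)"
proof -
  have "continuous_on T (\<lambda>t. f (fst (x, t)) (snd (x, t)))"
    by (rule continuous_on_compose2[OF assms(1) continuous_on_Pair[OF continuous_on_const continuous_on_id]])
      (use assms(2) in auto)
  then show ?thesis by simp
qed

lemma continuous_on_weight:
  "continuous_on T w \<Longrightarrow> continuous_on (S \<times> T) (\<lambda>y. w (snd y))"
  by (rule continuous_on_compose2[OF _ continuous_on_snd[OF continuous_on_id]]) auto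

text \<open>Differentiating under the integral in direction \<open>v\<close> replaces
  \<open>F\<close> by its derivative along \<open>v\<close> and multiplies the weight by
  \<open>t\<close>. The integral keeps its form, which is why both \<open>F\<close> and
  \<open>w\<close> vary in the induction.\<close>

lemma smooth_on_segment_integral:
  fixes S :: "'e::euclidean_space set" and F :: "'e \<Rightarrow> real" and w :: "real \<Rightarrow> real"
  assumes S: "open S" "convex S" and q: "q \<in> S" and F: "smooth_on S F" and w: "continuous_on {0..1} w"
  shows "smooth_on S (\<lambda>x. integral {0..1} (\<lambda>t. w t * F (q + t *\<^sub>R (x - q))))"
proof -
  have cont: "continuous_on (S \<times> {0..1}) (\<lambda>y. w (snd y) * F (q + snd y *\<^sub>R (fst y - q)))"
    if w: "continuous_on {0..1} w" and F: "smooth_on S F" for F :: "'e \<Rightarrow> real" and w :: "real \<Rightarrow> real"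
    by (rule continuous_on_mult[OF continuous_on_weight[OF w] continuous_on_segment[OF S(2) q smooth_on_continuous[OF F]]])
  have "Ck_on k S (\<lambda>x. integral {0..1} (\<lambda>t. w t * F (q + t *\<^sub>R (x - q))))" for k
    using F w
  proof (induction k arbitrary: F w)
    case 0
    show ?case
      using integral_continuous_on_param[of S 0 1 "\<lambda>x t. w t * F (q + t *\<^sub>R (x - q))", unfolded case_prod_unfold box_real, OF cont[OF 0(2) 0(1)]]
      by simp
  next
    case (Suc k)
    \<comment> \<open>The Leibniz rule for integrals takes the derivative as a bounded linear map
      depending continuously on the point; in finite dimension this continuity can be checked on
      basis vectors.\<close>
    define DF where "DF y = Blinfun (frechet_derivative F (at y))" for y
    have DF: "blinfun_apply (DF y) = frechet_derivative F (at y)" if "y \<in> S" for y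
      unfolding DF_def
      by (rule bounded_linear_Blinfun_apply[OF has_derivative_bounded_linear[OF smooth_onD[OF Suc.prems(1) that]]])
    have contDF: "continuous_on S DF"
    proof (rule continuous_on_blinfun_componentwise)
      fix i :: 'e
      show "continuous_on S (\<lambda>y. blinfun_apply (DF y) i)"
        using smooth_on_continuous[OF smooth_on_frechet[OF Suc.prems(1), of i]] DF
        by (simp cong: continuous_on_cong)
    qed
    have seg: "q + t *\<^sub>R (x - q) \<in> S" if "x \<in> S" "0 \<le> t" "t \<le> 1" for x t
      using convexD_alt[OF S(2) q that] by (simp add: algebra_simps)
    define G where "G x t = (w t * t) *\<^sub>R DF (q + t *\<^sub>R (x - q))" for x t
    have contw: "continuous_on (S \<times> {0..1}) (\<lambda>y. w (snd y) * snd y)"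
      by (rule continuous_on_mult[OF continuous_on_weight[OF Suc.prems(2)] continuous_on_snd[OF continuous_on_id]])
    have contG: "continuous_on (S \<times> {0..1}) (\<lambda>y. G (fst y) (snd y))"
      unfolding G_def
      by (rule continuous_on_scaleR[OF contw continuous_on_segment[OF S(2) q contDF]])
    have fx: "((\<lambda>x. w t * F (q + t *\<^sub>R (x - q))) has_derivative blinfun_apply (G x t)) (at x within S)"
      if "x \<in> S" "t \<in> {0..1}" for x t
    proof -
      have L: "((\<lambda>x. q + t *\<^sub>R (x - q)) has_derivative (\<lambda>v. t *\<^sub>R v)) (at x within S)"
        by (auto intro!: derivative_eq_intros)
      have F': "(F has_derivative frechet_derivative F (at (q + t *\<^sub>R (x - q)))) (at (q + t *\<^sub>R (x - q)))"
        using smooth_onD[OF Suc.prems(1) seg] that by auto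
      have lin: "linear (frechet_derivative F (at (q + t *\<^sub>R (x - q))))"
        using F' by (simp add: has_derivative_linear)
      show ?thesis
        by (rule has_derivative_eq_rhs[OF has_derivative_mult_right[OF has_derivative_compose[OF L F']]])
          (use that in \<open>auto simp: G_def DF seg blinfun.scaleR_left linear_cmul[OF lin]\<close>)
    qed
    have int: "(\<lambda>t. w t * F (q + t *\<^sub>R (x - q))) integrable_on {0..1}" if "x \<in> S" for x
      by (rule integrable_continuous_real[OF continuous_on_section[OF cont[OF Suc.prems(2) Suc.prems(1)] that]])
    have D: "((\<lambda>x. integral {0..1} (\<lambda>t. w t * F (q + t *\<^sub>R (x - q))))
        has_derivative blinfun_apply (integral {0..1} (G x))) (at x)" if "x \<in> S" for x
      using leibniz_rule[of S 0 1 "\<lambda>x t. w t * F (q + t *\<^sub>R (x - q))" G x,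
          unfolded case_prod_unfold box_real, OF fx int contG that S(2)]
      by (simp only: at_within_open[OF that S(1)])
    have Gv: "blinfun_apply (integral {0..1} (G x)) v =
        integral {0..1} (\<lambda>t. (w t * t) * frechet_derivative F (at (q + t *\<^sub>R (x - q))) v)"
      if "x \<in> S" for x v
    proof -
      have "G x integrable_on {0..1}"
        by (rule integrable_continuous_real[OF continuous_on_section[OF contG that]])
      then have "blinfun_apply (integral {0..1} (G x)) v = integral {0..1} (\<lambda>t. blinfun_apply (G x t) v)"
        by (simp add: blinfun_apply_integral)
      also have "\<dots> = integral {0..1} (\<lambda>t. (w t * t) * frechet_derivative F (at (q + t *\<^sub>R (x - q))) v)"
        by (rule integral_cong) (use that in \<open>auto simp: G_def DF seg blinfun.scaleR_left\<close>)
      finally show ?thesis .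
    qed
    show ?case
    proof (rule Ck_on_SucI[OF S(1) D], assumption)
      fix v
      have "Ck_on k S (\<lambda>x. integral {0..1} (\<lambda>t. (w t * t) * frechet_derivative F (at (q + t *\<^sub>R (x - q))) v))"
        by (rule Suc.IH) (auto intro: smooth_on_frechet Suc.prems continuous_intros)
      then show "Ck_on k S (\<lambda>x. blinfun_apply (integral {0..1} (G x)) v)"
        by (rule Ck_on_cong[OF S(1), rotated]) (simp add: Gv)
    qed
  qed
  then show ?thesis by (simp add: smooth_on_def)
qed

text \<open>Integrate the derivative of \<open>F\<close> along the segment from \<open>q\<close> to
  \<open>x\<close> and expand it in the basis: \<open>g b\<close> is the mean of the partial
  derivative in direction \<open>b\<close>. At \<open>x = q\<close> the integrand is constant, which
  gives the last claim.\<close>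

lemma Hadamard:
  fixes S :: "'e::euclidean_space set" and F :: "'e \<Rightarrow> real"
  assumes S: "open S" "convex S" and q: "q \<in> S" and F: "smooth_on S F"
  obtains g where "\<And>b. smooth_on S (g b)"
    and "\<And>x. x \<in> S \<Longrightarrow> F x = F q + (\<Sum>b\<in>Basis. ((x - q) \<bullet> b) * g b x)"
    and "\<And>b. g b q = frechet_derivative F (at q) b"
proof -
  \<comment> \<open>The factor 1 is the initial weight of
    \<open>smooth_on_segment_integral\<close>.\<close>
  define g where "g b x = integral {0..1} (\<lambda>t. 1 * frechet_derivative F (at (q + t *\<^sub>R (x - q))) b)" for b x
  have 1: "smooth_on S (g b)" for b
    unfolding g_def
    by (rule smooth_on_segment_integral[OF S q smooth_on_frechet[OF F]]) simp
  have seg: "q + t *\<^sub>R (x - q) \<in> S" if "x \<in> S" "0 \<le> t" "t \<le> 1" for x t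
    using convexD_alt[OF S(2) q that] by (simp add: algebra_simps)
  have 2: "F x = F q + (\<Sum>b\<in>Basis. ((x - q) \<bullet> b) * g b x)" if x: "x \<in> S" for x
  proof -
    let ?d = "\<lambda>t b. frechet_derivative F (at (q + t *\<^sub>R (x - q))) b"
    have "((\<lambda>t. F (q + t *\<^sub>R (x - q))) has_vector_derivative (\<Sum>b\<in>Basis. ((x - q) \<bullet> b) * ?d t b))
        (at t within {0..1})" if t: "0 \<le> t" "t \<le> 1" for t
    proof -
      have L: "((\<lambda>t. q + t *\<^sub>R (x - q)) has_derivative (\<lambda>s. s *\<^sub>R (x - q))) (at t within {0..1})"
        by (auto intro!: derivative_eq_intros)
      have F': "(F has_derivative ?d t) (at (q + t *\<^sub>R (x - q)))"
        using smooth_onD[OF F seg[OF x t]] .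
      have lin: "linear (?d t)"
        using F' by (simp add: has_derivative_linear)
      have "?d t (x - q) = (\<Sum>b\<in>Basis. ((x - q) \<bullet> b) * ?d t b)"
        using arg_cong[OF euclidean_representation[of "x - q"], of "?d t"]
        by (simp add: linear_sum[OF lin] linear_cmul[OF lin])
      then show ?thesis
        unfolding has_vector_derivative_def
        by (intro has_derivative_eq_rhs[OF has_derivative_compose[OF L F']])
          (simp add: fun_eq_iff linear_cmul[OF lin])
    qed
    then have I: "((\<lambda>t. \<Sum>b\<in>Basis. ((x - q) \<bullet> b) * ?d t b) has_integral F x - F q) {0..1}"
      using fundamental_theorem_of_calculus[of 0 1 "\<lambda>t. F (q + t *\<^sub>R (x - q))"
          "\<lambda>t. \<Sum>b\<in>Basis. ((x - q) \<bullet> b) * ?d t b"] by simp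
    have "continuous_on {0..1} (\<lambda>t. ?d t b)" for b
      by (rule continuous_on_section[OF continuous_on_segment[OF S(2) q smooth_on_continuous[OF smooth_on_frechet[OF F, of b]]] x])
    then have "((\<lambda>t. ?d t b) has_integral g b x) {0..1}" for b
      by (simp add: g_def integrable_integral integrable_continuous_real)
    then have "((\<lambda>t. \<Sum>b\<in>Basis. ((x - q) \<bullet> b) * ?d t b) has_integral (\<Sum>b\<in>Basis. ((x - q) \<bullet> b) * g b x)) {0..1}"
      by (intro has_integral_sum has_integral_mult_right finite_Basis)
    from has_integral_unique[OF I this] show ?thesis by simp
  qed
  have 3: "g b q = frechet_derivative F (at q) b" for b
    by (simp add: g_def)
  show ?thesis using that 1 2 3 by blast
qed

section \<open>Smooth manifolds and local frames\<close>

lemma tangent_add: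
  "v \<in> tangent_space A p \<Longrightarrow> f \<in> smooth_funs A \<Longrightarrow> g \<in> smooth_funs A \<Longrightarrow> v (\<lambda>x. f x + g x) = v f + v g"
  by (auto simp: tangent_space_def plus_fun_def)

lemma tangent_scale:
  "v \<in> tangent_space A p \<Longrightarrow> f \<in> smooth_funs A \<Longrightarrow> v (\<lambda>x. c * f x) = c * v f"
  by (auto simp: tangent_space_def)

lemma tangent_mult:
  "v \<in> tangent_space A p \<Longrightarrow> f \<in> smooth_funs A \<Longrightarrow> g \<in> smooth_funs A \<Longrightarrow>
    v (\<lambda>x. f x * g x) = f p * v g + g p * v f"
  by (auto simp: tangent_space_def times_fun_def)

lemma tangent_outside: "v \<in> tangent_space A p \<Longrightarrow> f \<notin> smooth_funs A \<Longrightarrow> v f = 0"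
  by (auto simp: tangent_space_def)

lemma tangentI:
  assumes "\<And>f g. f \<in> smooth_funs A \<Longrightarrow> g \<in> smooth_funs A \<Longrightarrow> v (\<lambda>x. f x + g x) = v f + v g"
    and "\<And>c f. f \<in> smooth_funs A \<Longrightarrow> v (\<lambda>x. c * f x) = c * v f"
    and "\<And>f g. f \<in> smooth_funs A \<Longrightarrow> g \<in> smooth_funs A \<Longrightarrow> v (\<lambda>x. f x * g x) = f p * v g + g p * v f"
    and "\<And>f. f \<notin> smooth_funs A \<Longrightarrow> v f = 0"
  shows "v \<in> tangent_space A p"
  using assms by (auto simp: tangent_space_def plus_fun_def times_fun_def)

locale manifold =
  fixes A :: "('a::{t2_space, second_countable_topology}, 'e::euclidean_space) chart set"
  assumes smooth_manifold: "smooth_manifold A"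
begin

abbreviation "C \<equiv> smooth_funs A"
abbreviation "VF \<equiv> vector_fields A"
abbreviation "OF1 \<equiv> one_forms A"
abbreviation "TM \<equiv> tangent_space A"
abbreviation "TsM \<equiv> cotangent_space A"

lemma chart:
  assumes "(U, \<phi>) \<in> A"
  shows "open U" "open (\<phi> ` U)" "continuous_on U \<phi>" "continuous_on (\<phi> ` U) (inv_into U \<phi>)"
    and "\<And>x. x \<in> U \<Longrightarrow> inv_into U \<phi> (\<phi> x) = x"
  using smooth_manifold assms by (auto simp: smooth_manifold_def is_chart_def homeomorphism_def)

lemma chart_image_open:
  assumes "(U, \<phi>) \<in> A" "open W" "W \<subseteq> U"
  shows "open (\<phi> ` W)"
proof -
  have "\<phi> ` W = \<phi> ` U \<inter> inv_into U \<phi> -` W"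
    using assms(3) chart(5)[OF assms(1)] by force
  then show ?thesis
    using continuous_open_preimage[OF chart(4,2)[OF assms(1)] assms(2)] by simp
qed

lemma smooth_funs_iff:
  "f \<in> C \<longleftrightarrow> (\<forall>(U, \<phi>)\<in>A. smooth_on (\<phi> ` U) (\<lambda>y. f (inv_into U \<phi> y)))"
  by (simp add: smooth_funs_def comp_def)

lemma smooth_funs_const: "(\<lambda>_. c) \<in> C"
  by (auto simp: smooth_funs_iff intro!: smooth_on_const chart(2))

lemma smooth_funs_add: "f \<in> C \<Longrightarrow> g \<in> C \<Longrightarrow> (\<lambda>x. f x + g x) \<in> C"
  by (auto simp: smooth_funs_iff intro!: smooth_on_add chart(2))

lemma smooth_funs_mult: "f \<in> C \<Longrightarrow> g \<in> C \<Longrightarrow> (\<lambda>x. f x * g x) \<in> C"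
  by (auto simp: smooth_funs_iff intro!: smooth_on_mult chart(2))

lemma smooth_funs_diff: "f \<in> C \<Longrightarrow> g \<in> C \<Longrightarrow> (\<lambda>x. f x - g x) \<in> C"
  using smooth_funs_add[OF _ smooth_funs_mult[OF smooth_funs_const[of "-1"]], of f g] by simp

lemma smooth_funs_sum:
  assumes "\<And>i. i \<in> I \<Longrightarrow> f i \<in> C"
  shows "(\<lambda>x. \<Sum>i\<in>I. f i x) \<in> C"
  using assms
  by (induction I rule: infinite_finite_induct) (auto intro: smooth_funs_const smooth_funs_add)

lemmas smooth_funs_intros =
  smooth_funs_const smooth_funs_add smooth_funs_mult smooth_funs_diff smooth_funs_sum

text \<open>Since 1 = 1 * 1, the Leibniz rule gives v(1) = 2 v(1).\<close>

lemma tangent_const: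
  assumes v: "v \<in> TM p"
  shows "v (\<lambda>_. c) = 0"
proof -
  have "v (\<lambda>_. 1) = 0"
    using tangent_mult[OF v smooth_funs_const[of 1] smooth_funs_const[of 1]] by simp
  then show ?thesis
    using tangent_scale[OF v smooth_funs_const[of 1], of c] by simp
qed

lemma tangent_sum:
  assumes v: "v \<in> TM p" and f: "\<And>i. i \<in> I \<Longrightarrow> f i \<in> C"
  shows "v (\<lambda>x. \<Sum>i\<in>I. f i x) = (\<Sum>i\<in>I. v (f i))"
  using f
proof (induction I rule: infinite_finite_induct)
  case (insert i I)
  then show ?case
    using tangent_add[OF v, of "f i" "\<lambda>x. \<Sum>i\<in>I. f i x"] by (simp add: smooth_funs_sum)
qed (auto simp: tangent_const[OF v])

lemma tangent_diff:
  assumes v: "v \<in> TM p" and f: "f \<in> C" "g \<in> C"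
  shows "v (\<lambda>x. f x - g x) = v f - v g"
  using tangent_add[OF v smooth_funs_diff[OF f] f(2)] by simp

lemma tangent_lincomb:
  assumes "\<And>i. i \<in> I \<Longrightarrow> v i \<in> TM p"
  shows "(\<lambda>f. \<Sum>i\<in>I. c i * v i f) \<in> TM p"
proof (rule tangentI)
  fix f g assume "f \<in> C" "g \<in> C"
  then show "(\<Sum>i\<in>I. c i * v i (\<lambda>x. f x + g x)) = (\<Sum>i\<in>I. c i * v i f) + (\<Sum>i\<in>I. c i * v i g)"
    using assms by (simp add: tangent_add[of _ A p] distrib_left sum.distrib)
next
  fix d f assume "f \<in> C"
  then show "(\<Sum>i\<in>I. c i * v i (\<lambda>x. d * f x)) = d * (\<Sum>i\<in>I. c i * v i f)"
    using assms by (simp add: tangent_scale[of _ A p] sum_distrib_left mult.left_commute)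
next
  fix f g assume "f \<in> C" "g \<in> C"
  then show "(\<Sum>i\<in>I. c i * v i (\<lambda>x. f x * g x)) = f p * (\<Sum>i\<in>I. c i * v i g) + g p * (\<Sum>i\<in>I. c i * v i f)"
    using assms
    by (simp add: tangent_mult[of _ A p] distrib_left sum.distrib sum_distrib_left mult.left_commute)
next
  fix f assume "f \<notin> C"
  then show "(\<Sum>i\<in>I. c i * v i f) = 0"
    using assms by (simp add: tangent_outside[of _ A p])
qed

lemma vector_fieldI:
  assumes "\<And>p. X p \<in> TM p" "\<And>f. f \<in> C \<Longrightarrow> (\<lambda>p. X p f) \<in> C"
  shows "X \<in> VF"
  using assms by (simp add: vector_fields_def act_def)

lemma vector_fieldD:
  assumes "X \<in> VF"
  shows "X p \<in> TM p" "f \<in> C \<Longrightarrow> (\<lambda>p. X p f) \<in> C"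
  using assms by (auto simp: vector_fields_def act_def)

lemma vector_field_lincomb:
  assumes "\<And>i. i \<in> I \<Longrightarrow> X i \<in> VF" "\<And>i. i \<in> I \<Longrightarrow> a i \<in> C"
  shows "(\<lambda>p f. \<Sum>i\<in>I. a i p * X i p f) \<in> VF"
  using assms by (intro vector_fieldI tangent_lincomb smooth_funs_intros) (auto intro: vector_fieldD)

text \<open>In any other chart two open sets cover the domain: the part over \<open>S\<close>, where
  the function is \<open>G\<close> after a transition map, and the complement of the support, where
  it is 0. The support is closed because it is compact and the manifold is Hausdorff.\<close>

lemma smooth_funs_extend:
  assumes c: "(U, \<phi>) \<in> A" and S: "open S" "S \<subseteq> \<phi> ` U" and K: "compact K" "K \<subseteq> S"
    and G: "smooth_on S G" "\<And>y. y \<in> S \<Longrightarrow> y \<notin> K \<Longrightarrow> G y = 0"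
  shows "(\<lambda>q. if q \<in> U \<and> \<phi> q \<in> S then G (\<phi> q) else 0) \<in> C" (is "?F \<in> C")
  unfolding smooth_funs_iff
proof (clarify)
  fix V \<psi> assume d: "(V, \<psi>) \<in> A"
  define B where "B = U \<inter> \<phi> -` S"
  define D where "D = inv_into U \<phi> ` K"
  have "open B"
    unfolding B_def by (rule continuous_open_preimage[OF chart(3,1)[OF c] S(1)])
  have "compact D"
    unfolding D_def
    by (rule compact_continuous_image[OF continuous_on_subset[OF chart(4)[OF c]] K(1)]) (use S K in auto)
  then have "closed D" by (rule compact_imp_closed)
  have D: "D \<subseteq> B"
    using S K chart(5)[OF c] by (fastforce simp: D_def B_def)
  have zero: "G (\<phi> q) = 0" if "q \<notin> D" "q \<in> U" "\<phi> q \<in> S" for q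
    using that G(2) chart(5)[OF c] by (force simp: D_def)
  have o1: "open (\<psi> ` (B \<inter> V))"
    by (rule chart_image_open[OF d]) (use \<open>open B\<close> chart(1)[OF d] in auto)
  have o2: "open (\<psi> ` (V - D))"
    by (rule chart_image_open[OF d]) (use \<open>closed D\<close> chart(1)[OF d] in auto)
  have "smooth_on (\<psi> ` (V \<inter> U)) (\<phi> \<circ> inv_into V \<psi>)"
    using smooth_manifold c d by (auto simp: smooth_manifold_def)
  then have "smooth_on (\<psi> ` (B \<inter> V)) (\<phi> \<circ> inv_into V \<psi>)"
    by (rule smooth_on_subset) (auto simp: B_def)
  then have "smooth_on (\<psi> ` (B \<inter> V)) (\<lambda>y. G ((\<phi> \<circ> inv_into V \<psi>) y))"
    by (rule smooth_on_compose[OF o1 G(1)]) (auto simp: chart(5)[OF d] B_def)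
  then have 1: "smooth_on (\<psi> ` (B \<inter> V)) (\<lambda>y. ?F (inv_into V \<psi> y))"
    by (rule smooth_on_cong[OF o1, rotated]) (auto simp: chart(5)[OF d] B_def)
  have 2: "smooth_on (\<psi> ` (V - D)) (\<lambda>y. ?F (inv_into V \<psi> y))"
    by (rule smooth_on_cong[OF o2 _ smooth_on_const[OF o2, of 0]]) (auto simp: chart(5)[OF d] zero)
  have "\<psi> ` (B \<inter> V) \<union> \<psi> ` (V - D) = \<psi> ` V"
    using D by auto
  then show "smooth_on (\<psi> ` V) (\<lambda>y. ?F (inv_into V \<psi> y))"
    using smooth_on_Un[OF o1 o2 1 2] by simp
qed

text \<open>With a cutoff \<open>\<rho>\<close> in a chart, \<open>\<rho>\<^sup>2 v(f) = \<Sum>\<^sub>b (v(\<rho> x\<^sub>b) - x\<^sub>b v(\<rho>)) \<rho> \<partial>\<^sub>b f\<close> by Hadamard's lemma. The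
  index \<open>None\<close> belongs to the function \<open>\<rho>\<close>; this correction term makes a second cutoff, equal to \<open>1\<close> on
  the support of \<open>\<rho>\<close>, unnecessary.\<close>

lemma local_frame:
  fixes p :: 'a
  obtains I :: "'e option set" and x E \<zeta> where
    "\<And>i. i \<in> I \<Longrightarrow> x i \<in> C" "\<And>i. i \<in> I \<Longrightarrow> E i \<in> VF" "\<zeta> \<in> C" "\<zeta> p = 1"
    "\<And>q v f. v \<in> TM q \<Longrightarrow> f \<in> C \<Longrightarrow> \<zeta> q * v f = (\<Sum>i\<in>I. v (x i) * E i q f)"
proof -
  obtain U \<phi> where c: "(U, \<phi>) \<in> A" and p: "p \<in> U"
    using smooth_manifold unfolding smooth_manifold_def by (metis UN_E UNIV_I prod.collapse)
  obtain R where R: "R > 0" "ball (\<phi> p) R \<subseteq> \<phi> ` U"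
    using chart(2)[OF c] p by (meson imageI openE)
  define S where "S = ball (\<phi> p) R"
  have S: "open S" "convex S" "S \<subseteq> \<phi> ` U"
    using R by (auto simp: S_def)
  \<comment> \<open>Half the radius leaves a compact ball inside \<open>S\<close> that contains the
    support of \<rho>.\<close>
  define \<rho> where "\<rho> = bump (\<phi> p) (R / 2)"
  have rho_zero: "\<rho> y = 0" if "y \<notin> cball (\<phi> p) (R / 2)" for y
    using that R by (auto simp: \<rho>_def intro!: bump_zero)
  have rho_pos: "\<rho> (\<phi> p) > 0"
    unfolding \<rho>_def by (rule bump_pos) (use R in simp)
  have smooth_rho: "smooth_on S \<rho>"
    unfolding \<rho>_def by (rule smooth_on_subset[OF smooth_on_bump]) simp
  define B where "B = {q \<in> U. \<phi> q \<in> S}"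
  have pB: "p \<in> B"
    using p R by (auto simp: B_def S_def)
  \<comment> \<open>With the factor \<rho> built in, every smooth function on \<open>S\<close>,
    whatever its growth near the boundary, becomes a global smooth function.\<close>
  define ext where "ext G q = (if q \<in> B then \<rho> (\<phi> q) * G (\<phi> q) else 0)" for G q
  have ext: "ext G \<in> C" if "smooth_on S G" for G
  proof -
    have "(\<lambda>q. if q \<in> U \<and> \<phi> q \<in> S then \<rho> (\<phi> q) * G (\<phi> q) else 0) \<in> C"
      by (rule smooth_funs_extend[OF c S(1,3), of "cball (\<phi> p) (R / 2)"])
        (use R rho_zero in \<open>auto simp: S_def intro!: smooth_on_mult smooth_rho[unfolded S_def] that[unfolded S_def]\<close>)
    then show ?thesis by (simp add: ext_def[abs_def] B_def)
  qed
  define loc where "loc f y = f (inv_into U \<phi> y)" for f :: "'a \<Rightarrow> real" and y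
  have loc: "smooth_on S (loc f)" if "f \<in> C" for f
    using that c S(3) unfolding smooth_funs_iff loc_def by (auto intro: smooth_on_subset)
  have loc_at: "loc f (\<phi> q) = f q" if "q \<in> B" for f q
    using that chart(5)[OF c] by (auto simp: loc_def B_def)
  have Dloc: "(loc f has_derivative frechet_derivative (loc f) (at (\<phi> q))) (at (\<phi> q))"
    if "f \<in> C" "q \<in> B" for f q
    using smooth_onD[OF loc] that by (auto simp: B_def)
  define D where "D b f q = frechet_derivative (loc f) (at (\<phi> q)) b" for b f q
  have D_add: "D b (\<lambda>x. f x + g x) q = D b f q + D b g q" if "f \<in> C" "g \<in> C" "q \<in> B" for b f g q
    using fun_cong[OF frechet_derivative_at[OF has_derivative_add[OF Dloc[OF that(1,3)] Dloc[OF that(2,3)]]], of b, symmetric]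
    by (simp add: D_def loc_def[abs_def])
  have D_scale: "D b (\<lambda>x. d * f x) q = d * D b f q" if "f \<in> C" "q \<in> B" for b d f q
    using fun_cong[OF frechet_derivative_at[OF has_derivative_mult_right[OF Dloc[OF that], of d]], of b, symmetric]
    by (simp add: D_def loc_def[abs_def])
  have D_mult: "D b (\<lambda>x. f x * g x) q = f q * D b g q + g q * D b f q" if "f \<in> C" "g \<in> C" "q \<in> B" for b f g q
    using fun_cong[OF frechet_derivative_at[OF has_derivative_mult[OF Dloc[OF that(1,3)] Dloc[OF that(2,3)]]], of b, symmetric]
      loc_at[OF that(3)]
    by (simp add: D_def loc_def[abs_def] mult.commute)
  \<comment> \<open>This is the vector field \<rho> a \<partial>/\<partial>b, extended by zero. The
    value 0 on functions that are not smooth is the convention of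
    \<open>tangent_space\<close>.\<close>
  define pd where "pd b a q f = (if f \<in> C then ext (\<lambda>y. a y * frechet_derivative (loc f) (at y) b) q else 0)"
    for b a q f
  have pd: "pd b a \<in> VF" if a: "smooth_on S a" for a b
  proof (rule vector_fieldI)
    fix q
    show "pd b a q \<in> TM q"
      by (rule tangentI)
        (auto simp: pd_def ext_def smooth_funs_intros D_add[unfolded D_def] D_scale[unfolded D_def]
          D_mult[unfolded D_def] algebra_simps)
  next
    fix f assume f: "f \<in> C"
    then show "(\<lambda>q. pd b a q f) \<in> C"
      by (simp add: pd_def ext smooth_on_mult S a smooth_on_frechet loc)
  qed
  have smooth_S: "smooth_on S (\<lambda>_. 1)" "smooth_on S (\<lambda>y. y \<bullet> b)" for b
    by (intro smooth_on_const smooth_on_component S)+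
  define X0 where "X0 b = ext (\<lambda>y. y \<bullet> b)" for b
  define X1 where "X1 = ext (\<lambda>_. 1)"
  have X: "X0 b \<in> C" "X1 \<in> C" for b
    by (auto simp: X0_def X1_def intro!: ext smooth_S)
  \<comment> \<open>All correction terms -x_b v(\<rho>) share the factor v(\<rho>); \<open>N\<close>
    is the field that multiplies it.\<close>
  define N where "N q f = (\<Sum>b\<in>Basis. (-1) * pd b (\<lambda>y. y \<bullet> b) q f)" for q f
  have N: "N \<in> VF"
    unfolding N_def[abs_def]
    by (rule vector_field_lincomb[of Basis "\<lambda>b. pd b (\<lambda>y. y \<bullet> b)" "\<lambda>_ _. -1"])
      (auto intro: pd smooth_S smooth_funs_const)
  have frame: "X1 q * X1 q * v f = (\<Sum>b\<in>Basis. v (X0 b) * pd b (\<lambda>_. 1) q f) + v X1 * N q f"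
    if v: "v \<in> TM q" and f: "f \<in> C" for q v f
  proof (cases "q \<in> B")
    case False
    then show ?thesis using f by (simp add: X1_def N_def pd_def ext_def)
  next
    case q: True
    obtain g where g: "\<And>b. smooth_on S (g b)"
      and gF: "\<And>x. x \<in> S \<Longrightarrow> loc f x = loc f (\<phi> q) + (\<Sum>b\<in>Basis. ((x - \<phi> q) \<bullet> b) * g b x)"
      and gq: "\<And>b. g b (\<phi> q) = frechet_derivative (loc f) (at (\<phi> q)) b"
      using Hadamard[OF S(1,2) _ loc[OF f], of "\<phi> q"] q by (auto simp: B_def)
    \<comment> \<open>Hadamard's formula holds only on \<open>S\<close>. Multiplied by \<rho>
      squared, with one \<rho> given to each factor, it becomes an identity between global smooth
      functions, to which \<open>v\<close> can be applied.\<close>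
    have id: "(\<lambda>s. (X1 s * X1 s) * (f s - f q)) =
        (\<lambda>s. \<Sum>b\<in>Basis. (X0 b s - (\<phi> q \<bullet> b) * X1 s) * ext (g b) s)"
    proof
      fix s
      show "(X1 s * X1 s) * (f s - f q) = (\<Sum>b\<in>Basis. (X0 b s - (\<phi> q \<bullet> b) * X1 s) * ext (g b) s)"
      proof (cases "s \<in> B")
        case True
        then have "f s - f q = (\<Sum>b\<in>Basis. ((\<phi> s - \<phi> q) \<bullet> b) * g b (\<phi> s))"
          using gF[of "\<phi> s"] loc_at[of _ f] q by (simp add: B_def)
        with True show ?thesis
          by (simp add: X1_def X0_def ext_def sum_distrib_left inner_diff_left algebra_simps)
      qed (simp add: X1_def ext_def)
    qed
    \<comment> \<open>The factor \<open>f s - f q\<close> vanishes at \<open>q\<close>, so the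
      Leibniz rule leaves one term. The same happens on the other side with
      \<open>X0 b s - (\<phi> q \<bullet> b) * X1 s\<close>.\<close>
    have "v (\<lambda>s. (X1 s * X1 s) * (f s - f q)) = X1 q * X1 q * v f"
      by (subst tangent_mult[OF v])
        (auto intro!: smooth_funs_intros X f simp: tangent_diff[OF v f] smooth_funs_const tangent_const[OF v])
    moreover have "v (\<lambda>s. \<Sum>b\<in>Basis. (X0 b s - (\<phi> q \<bullet> b) * X1 s) * ext (g b) s)
        = (\<Sum>b\<in>Basis. (v (X0 b) - (\<phi> q \<bullet> b) * v X1) * ext (g b) q)"
    proof (subst tangent_sum[OF v])
      show "(\<Sum>b\<in>Basis. v (\<lambda>s. (X0 b s - (\<phi> q \<bullet> b) * X1 s) * ext (g b) s)) =
          (\<Sum>b\<in>Basis. (v (X0 b) - (\<phi> q \<bullet> b) * v X1) * ext (g b) q)"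
      proof (rule sum.cong[OF refl])
        fix b :: 'e
        have "X0 b q - (\<phi> q \<bullet> b) * X1 q = 0"
          using q by (simp add: X0_def X1_def ext_def)
        moreover have "v (\<lambda>s. X0 b s - (\<phi> q \<bullet> b) * X1 s) = v (X0 b) - (\<phi> q \<bullet> b) * v X1"
          by (simp add: tangent_diff[OF v] tangent_scale[OF v] X smooth_funs_mult[OF smooth_funs_const])
        ultimately show "v (\<lambda>s. (X0 b s - (\<phi> q \<bullet> b) * X1 s) * ext (g b) s) =
            (v (X0 b) - (\<phi> q \<bullet> b) * v X1) * ext (g b) q"
          by (subst tangent_mult[OF v]) (auto intro!: smooth_funs_intros X ext g)
      qed
    qed (auto intro!: smooth_funs_intros X ext g)
    ultimately have "X1 q * X1 q * v f = (\<Sum>b\<in>Basis. (v (X0 b) - (\<phi> q \<bullet> b) * v X1) * ext (g b) q)"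
      using id by simp
    also have "\<dots> = (\<Sum>b\<in>Basis. v (X0 b) * pd b (\<lambda>_. 1) q f) + v X1 * N q f"
      using q f by (simp add: N_def pd_def ext_def gq sum_distrib_left sum_negf sum_subtractf algebra_simps)
    finally show ?thesis .
  qed
  \<comment> \<open>Dividing by this constant normalises the cutoff to 1 at \<open>p\<close>; it is
    nonzero because \<rho> is positive at the centre of its ball.\<close>
  define k where "k = X1 p * X1 p"
  have k: "k \<noteq> 0"
    using pB rho_pos by (simp add: k_def X1_def ext_def)
  define x where "x = case_option X1 X0"
  define E where "E = case_option (\<lambda>q f. inverse k * N q f) (\<lambda>b q f. inverse k * pd b (\<lambda>_. 1) q f)"
  have scale: "(\<lambda>q f. inverse k * Y q f) \<in> VF" if "Y \<in> VF" for Y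
    using vector_field_lincomb[of "{()}" "\<lambda>_. Y" "\<lambda>_ _. inverse k"] that by (simp add: smooth_funs_const)
  show ?thesis
  proof (rule that[of "insert None (Some ` Basis)" x E "\<lambda>q. inverse k * (X1 q * X1 q)"])
    show "x i \<in> C" for i
      by (cases i) (auto simp: x_def X)
    show "E i \<in> VF" for i
      by (cases i) (auto simp: E_def intro!: scale N pd smooth_S)
    show "(\<lambda>q. inverse k * (X1 q * X1 q)) \<in> C"
      by (intro smooth_funs_intros X)
    show "inverse k * (X1 p * X1 p) = 1"
      using k unfolding k_def by (rule left_inverse)
    fix q v f assume "v \<in> TM q" "f \<in> C"
    from frame[OF this] show "inverse k * (X1 q * X1 q) * v f = (\<Sum>i\<in>insert None (Some ` Basis). v (x i) * E i q f)"
      by (simp add: x_def E_def sum.reindex comp_def sum_distrib_left[symmetric] mult_ac distrib_left)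
  qed
qed

end

section \<open>Sections as modules over the smooth functions\<close>

lemma cotangent_add:
  "\<omega> \<in> cotangent_space A p \<Longrightarrow> v \<in> tangent_space A p \<Longrightarrow> w \<in> tangent_space A p \<Longrightarrow> \<omega> (v + w) = \<omega> v + \<omega> w"
  by (auto simp: cotangent_space_def)

lemma cotangent_scale:
  "\<omega> \<in> cotangent_space A p \<Longrightarrow> v \<in> tangent_space A p \<Longrightarrow> \<omega> (\<lambda>f. c * v f) = c * \<omega> v"
  by (auto simp: cotangent_space_def)

lemma cotangent_outside: "\<omega> \<in> cotangent_space A p \<Longrightarrow> v \<notin> tangent_space A p \<Longrightarrow> \<omega> v = 0"
  by (auto simp: cotangent_space_def)

lemma cotangentI:
  assumes "\<And>v w. v \<in> tangent_space A p \<Longrightarrow> w \<in> tangent_space A p \<Longrightarrow> \<omega> (v + w) = \<omega> v + \<omega> w"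
    and "\<And>c v. v \<in> tangent_space A p \<Longrightarrow> \<omega> (\<lambda>f. c * v f) = c * \<omega> v"
    and "\<And>v. v \<notin> tangent_space A p \<Longrightarrow> \<omega> v = 0"
  shows "\<omega> \<in> cotangent_space A p"
  using assms by (auto simp: cotangent_space_def)

lemma fmul_apply [simp]: "(f \<odot> s) p t = f p * s p t"
  by (simp add: fmul_def)

context manifold
begin

lemma tangent_closed_add: "v \<in> TM p \<Longrightarrow> w \<in> TM p \<Longrightarrow> v + w \<in> TM p"
  using tangent_lincomb[of "UNIV :: bool set" "\<lambda>b. if b then v else w" p "\<lambda>_. 1"]
  by (simp add: UNIV_bool plus_fun_def add.commute)

lemma tangent_closed_scale: "v \<in> TM p \<Longrightarrow> (\<lambda>f. c * v f) \<in> TM p"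
  using tangent_lincomb[of "{()}" "\<lambda>_. v" p "\<lambda>_. c"] by simp

lemma tangent_eqI:
  assumes "v \<in> TM p" "w \<in> TM p" "\<And>f. f \<in> C \<Longrightarrow> v f = w f"
  shows "v = w"
  using assms tangent_outside by (metis ext)

lemma cotangent_lincomb_right:
  assumes \<omega>: "\<omega> \<in> TsM p" and v: "\<And>i. i \<in> I \<Longrightarrow> v i \<in> TM p"
  shows "\<omega> (\<lambda>f. \<Sum>i\<in>I. c i * v i f) = (\<Sum>i\<in>I. c i * \<omega> (v i))"
proof -
  have zero: "\<omega> (\<lambda>_. 0) = 0"
    using cotangent_scale[OF \<omega> tangent_lincomb[where I="{} :: unit set"], where c=0] by simp
  show ?thesis
    using v
  proof (induction I rule: infinite_finite_induct)
    case (insert i I)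
    have "(\<lambda>f. \<Sum>j\<in>insert i I. c j * v j f) = (\<lambda>f. c i * v i f) + (\<lambda>f. \<Sum>j\<in>I. c j * v j f)"
      using insert.hyps by (simp add: plus_fun_def)
    moreover have "\<omega> ((\<lambda>f. c i * v i f) + (\<lambda>f. \<Sum>j\<in>I. c j * v j f)) =
        \<omega> (\<lambda>f. c i * v i f) + \<omega> (\<lambda>f. \<Sum>j\<in>I. c j * v j f)"
      by (rule cotangent_add[OF \<omega>]) (auto intro!: tangent_closed_scale tangent_lincomb insert.prems)
    ultimately show ?case
      using insert cotangent_scale[OF \<omega>, of "v i" "c i"] by simp
  qed (simp_all add: zero)
qed

lemma cotangent_closed_add: "\<alpha> \<in> TsM p \<Longrightarrow> \<beta> \<in> TsM p \<Longrightarrow> \<alpha> + \<beta> \<in> TsM p"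
  by (rule cotangentI) (simp_all add: cotangent_add cotangent_scale cotangent_outside distrib_left)

lemma cotangent_closed_scale: "\<alpha> \<in> TsM p \<Longrightarrow> (\<lambda>v. c * \<alpha> v) \<in> TsM p"
  by (rule cotangentI) (simp_all add: cotangent_add cotangent_scale cotangent_outside distrib_left)

lemma cotangent_lincomb:
  assumes "\<And>i. i \<in> I \<Longrightarrow> \<alpha> i \<in> TsM p"
  shows "(\<lambda>v. \<Sum>i\<in>I. c i * \<alpha> i v) \<in> TsM p"
  using assms
proof (induction I rule: infinite_finite_induct)
  case (insert i I)
  then have "(\<lambda>v. c i * \<alpha> i v) + (\<lambda>v. \<Sum>i\<in>I. c i * \<alpha> i v) \<in> TsM p"
    by (intro cotangent_closed_add cotangent_closed_scale) auto
  then show ?case using insert.hyps by (simp add: plus_fun_def)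
qed (auto intro!: cotangentI)

lemma VF_fmul: "f \<in> C \<Longrightarrow> X \<in> VF \<Longrightarrow> f \<odot> X \<in> VF"
  using vector_field_lincomb[of "{()}" "\<lambda>_. X" "\<lambda>_. f"] by (simp add: fmul_def)

lemma VF_add: "X \<in> VF \<Longrightarrow> Y \<in> VF \<Longrightarrow> X + Y \<in> VF"
  using vector_field_lincomb[of "UNIV :: bool set" "\<lambda>b. if b then X else Y" "\<lambda>_ _. 1"]
  by (simp add: UNIV_bool plus_fun_def add.commute smooth_funs_const)

lemma VF_zero: "0 \<in> VF"
  using vector_field_lincomb[of "{}"] by (simp add: zero_fun_def)

lemma VF_diff: "X \<in> VF \<Longrightarrow> Y \<in> VF \<Longrightarrow> X - Y \<in> VF"
  using vector_field_lincomb[of "UNIV :: bool set" "\<lambda>b. if b then X else Y" "\<lambda>b _. if b then 1 else -1"]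
  by (simp add: UNIV_bool fun_diff_def smooth_funs_const)

lemma VF_eqI:
  assumes "X \<in> VF" "Y \<in> VF" "\<And>f. f \<in> C \<Longrightarrow> act X f = act Y f"
  shows "X = Y"
proof
  fix p show "X p = Y p"
    using assms by (intro tangent_eqI[OF vector_fieldD(1) vector_fieldD(1)]) (auto simp: act_def fun_eq_iff)
qed

text \<open>Freeze the frame coefficients of \<open>v\<close> at \<open>p\<close> as constants: the
  resulting combination of the global fields is smooth, and at \<open>p\<close>, where the cutoff is
  1, it equals \<open>v\<close>.\<close>

lemma vector_field_through:
  assumes v: "v \<in> TM p"
  obtains X where "X \<in> VF" "X p = v"
proof -
  obtain I :: "'e option set" and x E \<zeta> where x: "\<And>i. i \<in> I \<Longrightarrow> x i \<in> C"
    and E: "\<And>i. i \<in> I \<Longrightarrow> E i \<in> VF" and \<zeta>: "\<zeta> \<in> C" "\<zeta> p = 1"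
    and frame: "\<And>q v f. v \<in> TM q \<Longrightarrow> f \<in> C \<Longrightarrow> \<zeta> q * v f = (\<Sum>i\<in>I. v (x i) * E i q f)"
    using local_frame[of p] by blast
  have "(\<lambda>q f. \<Sum>i\<in>I. v (x i) * E i q f) \<in> VF"
    by (rule vector_field_lincomb[OF E]) (auto intro: smooth_funs_const)
  moreover have "(\<lambda>f. \<Sum>i\<in>I. v (x i) * E i p f) = v"
    using frame[OF v] \<zeta> by (intro tangent_eqI[OF tangent_lincomb v]) (auto intro: vector_fieldD E)
  ultimately show ?thesis using that by blast
qed

section \<open>Tensoriality and the construction of one-forms\<close>

definition C_linear :: "('a vfield \<Rightarrow> 'a \<Rightarrow> real) \<Rightarrow> bool" where
  "C_linear L \<longleftrightarrow> (\<forall>X\<in>VF. \<forall>Y\<in>VF. L (X + Y) = L X + L Y) \<and> (\<forall>f\<in>C. \<forall>X\<in>VF. L (f \<odot> X) = f * L X)"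

lemma C_linear_lincomb:
  assumes L: "C_linear L" and X: "\<And>i. i \<in> I \<Longrightarrow> X i \<in> VF" and a: "\<And>i. i \<in> I \<Longrightarrow> a i \<in> C"
  shows "L (\<lambda>p f. \<Sum>i\<in>I. a i p * X i p f) p = (\<Sum>i\<in>I. a i p * L (X i) p)"
proof -
  have "L ((\<lambda>_. 0) \<odot> 0) = (\<lambda>_. 0) * L 0"
    using L VF_zero smooth_funs_const unfolding C_linear_def by blast
  then have zero: "L (\<lambda>_ _. 0) p = 0"
    by (simp add: fmul_def zero_fun_def times_fun_def)
  show ?thesis
    using X a
  proof (induction I rule: infinite_finite_induct)
    case (insert i I)
    have "(\<lambda>p f. \<Sum>i\<in>insert i I. a i p * X i p f) = (a i \<odot> X i) + (\<lambda>p f. \<Sum>i\<in>I. a i p * X i p f)"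
      using insert.hyps by (simp add: fun_eq_iff)
    moreover have "L ((a i \<odot> X i) + (\<lambda>p f. \<Sum>i\<in>I. a i p * X i p f)) =
        L (a i \<odot> X i) + L (\<lambda>p f. \<Sum>i\<in>I. a i p * X i p f)"
    proof -
      have "a i \<odot> X i \<in> VF" "(\<lambda>p f. \<Sum>i\<in>I. a i p * X i p f) \<in> VF"
        by (auto intro!: VF_fmul vector_field_lincomb insert.prems)
      then show ?thesis using L by (simp add: C_linear_def)
    qed
    moreover have "L (a i \<odot> X i) = a i * L (X i)"
      using L insert.prems by (simp add: C_linear_def)
    ultimately show ?case
      using insert by simp
  qed (simp_all add: zero)
qed

text \<open>Multiplying by the cutoff \<open>\<zeta>\<close> of a local frame turns the field into a combination of the global
  fields \<open>E\<^sub>i\<close> with global coefficients, so a \<open>C\<close>-linear map only sees the value at the point.\<close>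

lemma C_linear_tensorial:
  assumes L: "C_linear L" and X: "X \<in> VF" "Y \<in> VF" and eq: "X p = Y p"
  shows "L X p = L Y p"
proof -
  obtain I :: "'e option set" and x E \<zeta> where x: "\<And>i. i \<in> I \<Longrightarrow> x i \<in> C"
    and E: "\<And>i. i \<in> I \<Longrightarrow> E i \<in> VF" and \<zeta>: "\<zeta> \<in> C" "\<zeta> p = 1"
    and frame: "\<And>q v f. v \<in> TM q \<Longrightarrow> f \<in> C \<Longrightarrow> \<zeta> q * v f = (\<Sum>i\<in>I. v (x i) * E i q f)"
    using local_frame[of p] by blast
  have "L Z p = (\<Sum>i\<in>I. Z p (x i) * L (E i) p)" if Z: "Z \<in> VF" for Z
  proof -
    have c: "(\<lambda>q. Z q (x i)) \<in> C" if "i \<in> I" for i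
      using vector_fieldD(2)[OF Z x[OF that]] .
    have "\<zeta> \<odot> Z = (\<lambda>q f. \<Sum>i\<in>I. Z q (x i) * E i q f)"
    proof (rule VF_eqI)
      show "(\<lambda>q f. \<Sum>i\<in>I. Z q (x i) * E i q f) \<in> VF"
        by (rule vector_field_lincomb[OF E c])
    qed (auto simp: act_def fun_eq_iff frame[OF vector_fieldD(1)[OF Z]] intro!: VF_fmul Z \<zeta>)
    moreover have "L (\<zeta> \<odot> Z) p = L Z p"
      using L \<zeta> Z by (simp add: C_linear_def)
    ultimately show ?thesis
      using C_linear_lincomb[OF L, of I E "\<lambda>i q. Z q (x i)" p] E c by simp
  qed
  then show ?thesis using X eq by simp
qed

lemma one_formI:
  "(\<And>p. \<alpha> p \<in> TsM p) \<Longrightarrow> (\<And>X. X \<in> VF \<Longrightarrow> pair \<alpha> X \<in> C) \<Longrightarrow> \<alpha> \<in> OF1"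
  by (simp add: one_forms_def)

lemma one_formD: "\<alpha> \<in> OF1 \<Longrightarrow> \<alpha> p \<in> TsM p" "\<alpha> \<in> OF1 \<Longrightarrow> X \<in> VF \<Longrightarrow> pair \<alpha> X \<in> C"
  by (auto simp: one_forms_def)

text \<open>Global fields pass through every tangent vector, and off the tangent space both sides
  vanish by convention.\<close>

lemma one_form_eqI:
  assumes \<alpha>: "\<alpha> \<in> OF1" and \<beta>: "\<beta> \<in> OF1" and eq: "\<And>X. X \<in> VF \<Longrightarrow> pair \<alpha> X = pair \<beta> X"
  shows "\<alpha> = \<beta>"
proof (rule ext)+
  fix p v
  show "\<alpha> p v = \<beta> p v"
  proof (cases "v \<in> TM p")
    case True
    then obtain X where "X \<in> VF" "X p = v" using vector_field_through by blast
    then show ?thesis using fun_cong[OF eq[of X], of p] by (simp add: pair_def)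
  next
    case False
    then show ?thesis
      by (simp add: cotangent_outside[OF one_formD(1)[OF \<alpha>]] cotangent_outside[OF one_formD(1)[OF \<beta>]])
  qed
qed

text \<open>The value on a tangent vector is that of \<open>L\<close> on any global field through
  it; \<open>C_linear_tensorial\<close> makes the choice irrelevant. Uniqueness, needed to evaluate
  the definite description, is \<open>one_form_eqI\<close>.\<close>

lemma form_of:
  assumes L: "C_linear L" and smooth: "\<And>X. X \<in> VF \<Longrightarrow> L X \<in> C"
  shows "form_of A L \<in> OF1" "\<And>X. X \<in> VF \<Longrightarrow> pair (form_of A L) X = L X"
proof -
  define \<gamma> where "\<gamma> p v = (if v \<in> TM p then L (SOME X. X \<in> VF \<and> X p = v) p else 0)" for p v
  have val: "\<gamma> p (X p) = L X p" if "X \<in> VF" for X p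
  proof -
    let ?Y = "SOME Y. Y \<in> VF \<and> Y p = X p"
    have "?Y \<in> VF \<and> ?Y p = X p"
      by (rule someI[where x=X]) (use that in simp)
    then show ?thesis
      using C_linear_tensorial[OF L, of ?Y X p] that by (simp add: \<gamma>_def vector_fieldD)
  qed
  then have pair: "pair \<gamma> X = L X" if "X \<in> VF" for X
    using that by (simp add: pair_def fun_eq_iff)
  have \<gamma>: "\<gamma> \<in> OF1"
  proof (rule one_formI)
    fix p show "\<gamma> p \<in> TsM p"
    proof (rule cotangentI)
      fix v w assume "v \<in> TM p" "w \<in> TM p"
      then obtain X Y where XY: "X \<in> VF" "X p = v" "Y \<in> VF" "Y p = w" using vector_field_through by metis
      then show "\<gamma> p (v + w) = \<gamma> p v + \<gamma> p w"
        using val[of X p] val[of Y p] val[OF VF_add[of X Y], of p] L by (simp add: C_linear_def)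
    next
      fix c v assume "v \<in> TM p"
      then obtain X where X: "X \<in> VF" "X p = v" using vector_field_through by metis
      moreover have "((\<lambda>_. c) \<odot> X) p = (\<lambda>f. c * v f)"
        using X by (simp add: fmul_def)
      ultimately show "\<gamma> p (\<lambda>f. c * v f) = c * \<gamma> p v"
        using val[of X p] val[OF VF_fmul[OF smooth_funs_const, of X c], of p] L
        by (simp add: C_linear_def smooth_funs_const)
    qed (simp add: \<gamma>_def)
  qed (simp add: pair smooth)
  have "form_of A L = \<gamma>"
    unfolding form_of_def
    by (rule the_equality) (auto simp: \<gamma> pair intro!: one_form_eqI)
  then show "form_of A L \<in> OF1" "\<And>X. X \<in> VF \<Longrightarrow> pair (form_of A L) X = L X"
    using \<gamma> pair by auto
qed

definition differential :: "('a \<Rightarrow> real) \<Rightarrow> 'a form" where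
  "differential f p v = (if v \<in> TM p then v f else 0)"

lemma differential:
  assumes "f \<in> C"
  shows "differential f \<in> OF1" "\<And>X. X \<in> VF \<Longrightarrow> pair (differential f) X = act X f"
proof -
  show 1: "pair (differential f) X = act X f" if "X \<in> VF" for X
    using that by (simp add: pair_def differential_def act_def vector_fieldD)
  show "differential f \<in> OF1"
    by (rule one_formI, rule cotangentI)
      (auto simp: differential_def tangent_closed_add tangent_closed_scale 1 act_def vector_fieldD assms)
qed

text \<open>The differentials alone already separate fields, because \<langle>df, X\<rangle> =
  X(f).\<close>

lemma VF_eqI_pair:
  assumes "X \<in> VF" "Y \<in> VF" "\<And>\<gamma>. \<gamma> \<in> OF1 \<Longrightarrow> pair \<gamma> X = pair \<gamma> Y"
  shows "X = Y"
  using assms differential by (intro VF_eqI) metis+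

lemma OF1_add: "\<alpha> \<in> OF1 \<Longrightarrow> \<beta> \<in> OF1 \<Longrightarrow> \<alpha> + \<beta> \<in> OF1"
  by (rule one_formI)
    (auto intro: cotangent_closed_add one_formD smooth_funs_add simp: pair_def
      dest: one_formD(2)[unfolded pair_def])

lemma OF1_fmul: "f \<in> C \<Longrightarrow> \<alpha> \<in> OF1 \<Longrightarrow> f \<odot> \<alpha> \<in> OF1"
  by (rule one_formI)
    (auto simp: fmul_def pair_def intro: cotangent_closed_scale one_formD smooth_funs_mult
      dest: one_formD(2)[unfolded pair_def])

lemma OF1_diff: "\<alpha> \<in> OF1 \<Longrightarrow> \<beta> \<in> OF1 \<Longrightarrow> \<alpha> - \<beta> \<in> OF1"
  using OF1_add[OF _ OF1_fmul[OF smooth_funs_const[of "-1"]], of \<alpha> \<beta>]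
  by (simp add: fmul_def plus_fun_def fun_diff_def)

lemma OF1_zero: "0 \<in> OF1"
  by (rule one_formI) (auto simp: pair_def smooth_funs_const zero_fun_def intro!: cotangentI)

end

section \<open>The anchor of a symmetric bivector field\<close>

lemma act_add_left [simp]: "act (X + Y) f = act X f + act Y f"
  by (simp add: act_def fun_eq_iff)

lemma act_diff_left [simp]: "act (X - Y) f = act X f - act Y f"
  by (simp add: act_def fun_eq_iff)

lemma act_fmul_left [simp]: "act (g \<odot> X) f = g * act X f"
  by (simp add: act_def fun_eq_iff)

lemma act_lie [simp]: "act (lie X Y) f = act X (act Y f) - act Y (act X f)"
  by (simp add: act_def lie_def fun_eq_iff)

lemma pair_add_left [simp]: "pair (\<alpha> + \<beta>) X = pair \<alpha> X + pair \<beta> X"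
  by (simp add: pair_def fun_eq_iff)

lemma pair_diff_left [simp]: "pair (\<alpha> - \<beta>) X = pair \<alpha> X - pair \<beta> X"
  by (simp add: pair_def fun_eq_iff)

lemma pair_fmul_left [simp]: "pair (f \<odot> \<alpha>) X = f * pair \<alpha> X"
  by (simp add: pair_def fun_eq_iff)

lemma pair_zero_left [simp]: "pair 0 X = 0"
  by (simp add: pair_def fun_eq_iff)

context manifold
begin

lemma C_add: "f \<in> C \<Longrightarrow> g \<in> C \<Longrightarrow> f + g \<in> C"
  and C_diff: "f \<in> C \<Longrightarrow> g \<in> C \<Longrightarrow> f - g \<in> C"
  and C_mult: "f \<in> C \<Longrightarrow> g \<in> C \<Longrightarrow> f * g \<in> C"
  by (simp_all add: plus_fun_def fun_diff_def times_fun_def smooth_funs_intros)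

lemma act_smooth: "X \<in> VF \<Longrightarrow> f \<in> C \<Longrightarrow> act X f \<in> C"
  by (simp add: vector_fields_def)

lemma act_add: "X \<in> VF \<Longrightarrow> f \<in> C \<Longrightarrow> g \<in> C \<Longrightarrow> act X (f + g) = act X f + act X g"
  by (simp add: act_def plus_fun_def tangent_add[OF vector_fieldD(1)])

lemma act_diff: "X \<in> VF \<Longrightarrow> f \<in> C \<Longrightarrow> g \<in> C \<Longrightarrow> act X (f - g) = act X f - act X g"
  by (simp add: act_def fun_diff_def tangent_diff[OF vector_fieldD(1)])

lemma act_mult: "X \<in> VF \<Longrightarrow> f \<in> C \<Longrightarrow> g \<in> C \<Longrightarrow> act X (f * g) = f * act X g + act X f * g"
  by (simp add: act_def times_fun_def plus_fun_def tangent_mult[OF vector_fieldD(1)] mult.commute)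

lemma act_const: "X \<in> VF \<Longrightarrow> act X (\<lambda>_. c) = 0"
  by (simp add: act_def zero_fun_def tangent_const[OF vector_fieldD(1)])

lemma pair_add: "\<alpha> \<in> OF1 \<Longrightarrow> X \<in> VF \<Longrightarrow> Y \<in> VF \<Longrightarrow> pair \<alpha> (X + Y) = pair \<alpha> X + pair \<alpha> Y"
  using cotangent_add[OF one_formD(1) vector_fieldD(1) vector_fieldD(1)]
  by (simp add: pair_def fun_eq_iff)

lemma pair_fmul: "\<alpha> \<in> OF1 \<Longrightarrow> X \<in> VF \<Longrightarrow> pair \<alpha> (f \<odot> X) = f * pair \<alpha> X"
  using cotangent_scale[OF one_formD(1) vector_fieldD(1)]
  by (simp add: pair_def fun_eq_iff fmul_def)

lemma pair_diff: "\<alpha> \<in> OF1 \<Longrightarrow> X \<in> VF \<Longrightarrow> Y \<in> VF \<Longrightarrow> pair \<alpha> (X - Y) = pair \<alpha> X - pair \<alpha> Y"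
  using pair_add[of \<alpha> "X - Y" Y] by (simp add: VF_diff)

end

locale affine_bivector =
  fixes A :: "('a::{t2_space, second_countable_topology}, 'e::euclidean_space) chart set"
    and nabla :: "'a vfield \<Rightarrow> 'a vfield \<Rightarrow> 'a vfield"
    and h :: "'a bivector"
  assumes affine: "affine_manifold A nabla"
    and bivector: "h \<in> symmetric_bivector_fields A"

sublocale affine_bivector \<subseteq> manifold A
  using affine by unfold_locales (simp add: affine_manifold_def)

context affine_bivector
begin

lemma nabla:
  shows nabla_VF: "X \<in> VF \<Longrightarrow> Y \<in> VF \<Longrightarrow> nabla X Y \<in> VF"
    and nabla_add_left: "X \<in> VF \<Longrightarrow> X' \<in> VF \<Longrightarrow> Y \<in> VF \<Longrightarrow> nabla (X + X') Y = nabla X Y + nabla X' Y"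
    and nabla_add: "X \<in> VF \<Longrightarrow> Y \<in> VF \<Longrightarrow> Y' \<in> VF \<Longrightarrow> nabla X (Y + Y') = nabla X Y + nabla X Y'"
    and nabla_fmul_left: "f \<in> C \<Longrightarrow> X \<in> VF \<Longrightarrow> Y \<in> VF \<Longrightarrow> nabla (f \<odot> X) Y = f \<odot> nabla X Y"
    and nabla_fmul: "f \<in> C \<Longrightarrow> X \<in> VF \<Longrightarrow> Y \<in> VF \<Longrightarrow> nabla X (f \<odot> Y) = f \<odot> nabla X Y + act X f \<odot> Y"
    and torsion: "X \<in> VF \<Longrightarrow> Y \<in> VF \<Longrightarrow> lie X Y = nabla X Y - nabla Y X"
    and flat: "X \<in> VF \<Longrightarrow> Y \<in> VF \<Longrightarrow> Z \<in> VF \<Longrightarrow>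
      nabla (lie X Y) Z = nabla X (nabla Y Z) - nabla Y (nabla X Z)"
  using affine unfolding affine_manifold_def is_connection_def real_bilinear_map_def by auto

lemma lie_VF: "X \<in> VF \<Longrightarrow> Y \<in> VF \<Longrightarrow> lie X Y \<in> VF"
  by (simp add: torsion nabla_VF VF_diff)

lemma sym_square:
  assumes "\<alpha> \<in> TsM p" "\<beta> \<in> TsM p"
  shows h_sym: "h p \<alpha> \<beta> = h p \<beta> \<alpha>"
    and h_add: "\<gamma> \<in> TsM p \<Longrightarrow> h p \<alpha> (\<beta> + \<gamma>) = h p \<alpha> \<beta> + h p \<alpha> \<gamma>"
    and h_scale: "h p \<alpha> (\<lambda>v. c * \<beta> v) = c * h p \<alpha> \<beta>"
proof -
  have h: "h p \<in> sym_square A p"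
    using bivector by (simp add: symmetric_bivector_fields_def)
  then have sym: "h p \<alpha> \<beta> = h p \<beta> \<alpha>" if "\<alpha> \<in> TsM p" "\<beta> \<in> TsM p" for \<alpha> \<beta>
    using that by (simp add: sym_square_def)
  show "h p \<alpha> \<beta> = h p \<beta> \<alpha>" using sym assms .
  show "h p \<alpha> (\<beta> + \<gamma>) = h p \<alpha> \<beta> + h p \<alpha> \<gamma>" if "\<gamma> \<in> TsM p"
  proof -
    have "h p (\<beta> + \<gamma>) \<alpha> = h p \<beta> \<alpha> + h p \<gamma> \<alpha>"
      using h assms that by (simp add: sym_square_def)
    then show ?thesis
      using sym[OF assms] sym[OF assms(1) that] sym[OF assms(1) cotangent_closed_add[OF assms(2) that]] by simp
  qed
  show "h p \<alpha> (\<lambda>v. c * \<beta> v) = c * h p \<alpha> \<beta>"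
  proof -
    have "h p (\<lambda>v. c * \<beta> v) \<alpha> = c * h p \<beta> \<alpha>"
      using h assms by (simp add: sym_square_def)
    then show ?thesis
      using sym[OF assms] sym[OF assms(1) cotangent_closed_scale[OF assms(2)]] by simp
  qed
qed

lemma h_lincomb:
  assumes \<alpha>: "\<alpha> \<in> TsM p" and \<beta>: "\<And>i. i \<in> I \<Longrightarrow> \<beta> i \<in> TsM p"
  shows "h p \<alpha> (\<lambda>v. \<Sum>i\<in>I. c i * \<beta> i v) = (\<Sum>i\<in>I. c i * h p \<alpha> (\<beta> i))"
proof -
  have zero: "h p \<alpha> (\<lambda>_. 0) = 0"
    using h_scale[OF \<alpha> \<alpha>, of 0] by simp
  show ?thesis
    using \<beta>
  proof (induction I rule: infinite_finite_induct)
    case (insert i I)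
    have "(\<lambda>v. \<Sum>j\<in>insert i I. c j * \<beta> j v) = (\<lambda>v. c i * \<beta> i v) + (\<lambda>v. \<Sum>j\<in>I. c j * \<beta> j v)"
      using insert.hyps by (simp add: plus_fun_def)
    moreover have "h p \<alpha> ((\<lambda>v. c i * \<beta> i v) + (\<lambda>v. \<Sum>j\<in>I. c j * \<beta> j v)) =
        h p \<alpha> (\<lambda>v. c i * \<beta> i v) + h p \<alpha> (\<lambda>v. \<Sum>j\<in>I. c j * \<beta> j v)"
      by (rule h_add[OF \<alpha>]) (auto intro!: cotangent_closed_scale cotangent_lincomb insert.prems)
    ultimately show ?case
      using insert h_scale[OF \<alpha>, of "\<beta> i" "c i"] by simp
  qed (simp_all add: zero)
qed

text \<open>Existence is reflexivity of the tangent space. At \<open>p\<close> the frame gives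
  \<beta> = \<Sum> \<beta>(E_i) dx_i for every covector, so v = \<Sum> h(\<alpha>, dx_i) E_i
  represents h(\<alpha>, -). The E_i only have to span for this. Uniqueness holds because
  differentials separate tangent vectors.\<close>

lemma sharp:
  assumes \<alpha>: "\<alpha> \<in> TsM p"
  shows "sharp A h p \<alpha> \<in> TM p" "\<And>\<beta>. \<beta> \<in> TsM p \<Longrightarrow> \<beta> (sharp A h p \<alpha>) = h p \<alpha> \<beta>"
    and "\<And>v. v \<in> TM p \<Longrightarrow> (\<And>\<beta>. \<beta> \<in> TsM p \<Longrightarrow> \<beta> v = h p \<alpha> \<beta>) \<Longrightarrow> sharp A h p \<alpha> = v"
proof -
  obtain I :: "'e option set" and x E \<zeta> where x: "\<And>i. i \<in> I \<Longrightarrow> x i \<in> C"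
    and E: "\<And>i. i \<in> I \<Longrightarrow> E i \<in> VF" and \<zeta>: "\<zeta> \<in> C" "\<zeta> p = 1"
    and frame: "\<And>q v f. v \<in> TM q \<Longrightarrow> f \<in> C \<Longrightarrow> \<zeta> q * v f = (\<Sum>i\<in>I. v (x i) * E i q f)"
    using local_frame[of p] by blast
  define v where "v f = (\<Sum>i\<in>I. h p \<alpha> (differential (x i) p) * E i p f)" for f
  have dx: "differential (x i) p \<in> TsM p" if "i \<in> I" for i
    using differential(1)[OF x[OF that]] one_formD(1) by blast
  have v: "v \<in> TM p"
    unfolding v_def[abs_def] by (rule tangent_lincomb) (auto intro: vector_fieldD E)
  have v\<beta>: "\<beta> v = h p \<alpha> \<beta>" if \<beta>: "\<beta> \<in> TsM p" for \<beta>
  proof -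
    have "\<beta> = (\<lambda>w. \<Sum>i\<in>I. \<beta> (E i p) * differential (x i) p w)"
    proof
      fix w show "\<beta> w = (\<Sum>i\<in>I. \<beta> (E i p) * differential (x i) p w)"
      proof (cases "w \<in> TM p")
        case True
        then have "w = (\<lambda>f. \<Sum>i\<in>I. w (x i) * E i p f)"
          using frame[OF True] \<zeta> by (intro tangent_eqI[OF True tangent_lincomb]) (auto intro: vector_fieldD E)
        then have "\<beta> w = \<beta> (\<lambda>f. \<Sum>i\<in>I. w (x i) * E i p f)" by simp
        then show ?thesis
          using True by (simp add: cotangent_lincomb_right[OF \<beta>] vector_fieldD(1)[OF E] differential_def mult.commute)
      qed (simp add: cotangent_outside[OF \<beta>] differential_def)
    qed
    then have "h p \<alpha> \<beta> = h p \<alpha> (\<lambda>w. \<Sum>i\<in>I. \<beta> (E i p) * differential (x i) p w)" by simp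
    also have "\<dots> = (\<Sum>i\<in>I. \<beta> (E i p) * h p \<alpha> (differential (x i) p))"
      by (rule h_lincomb[OF \<alpha> dx])
    also have "\<dots> = \<beta> v"
      unfolding v_def[abs_def]
      by (subst cotangent_lincomb_right[OF \<beta>]) (auto simp: mult.commute intro: vector_fieldD E)
    finally show ?thesis by simp
  qed
  have unique: "w = w'" if "w \<in> TM p" "w' \<in> TM p" "\<And>\<beta>. \<beta> \<in> TsM p \<Longrightarrow> \<beta> w = \<beta> w'" for w w'
  proof (rule tangent_eqI[OF that(1,2)])
    fix f assume "f \<in> C"
    then have "differential f p \<in> TsM p" using differential(1) one_formD(1) by blast
    from that(3)[OF this] show "w f = w' f" using that by (simp add: differential_def)
  qed
  have eq: "sharp A h p \<alpha> = w" if "w \<in> TM p" "\<And>\<beta>. \<beta> \<in> TsM p \<Longrightarrow> \<beta> w = h p \<alpha> \<beta>" for w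
    unfolding sharp_def by (rule the_equality) (auto simp: that intro!: unique)
  show "sharp A h p \<alpha> \<in> TM p" "\<And>\<beta>. \<beta> \<in> TsM p \<Longrightarrow> \<beta> (sharp A h p \<alpha>) = h p \<alpha> \<beta>"
    using eq[OF v v\<beta>] v v\<beta> by auto
  show "\<And>v. v \<in> TM p \<Longrightarrow> (\<And>\<beta>. \<beta> \<in> TsM p \<Longrightarrow> \<beta> v = h p \<alpha> \<beta>) \<Longrightarrow> sharp A h p \<alpha> = v"
    using eq by blast
qed

text \<open>Fibrewise linearity follows from the uniqueness clause of \<open>sharp\<close>, and
  smoothness from (\<sharp>\<alpha>)(f) = h(\<alpha>, df).\<close>

lemma sharp_bundle_map: "is_bundle_map A (sharp A h)"
proof -
  have add: "sharp A h p (\<alpha> + \<beta>) = sharp A h p \<alpha> + sharp A h p \<beta>" if "\<alpha> \<in> TsM p" "\<beta> \<in> TsM p" for p \<alpha> \<beta>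
    using that
    by (intro sharp(3) cotangent_closed_add tangent_closed_add sharp(1))
      (simp_all add: cotangent_add sharp h_sym[of "\<alpha> + \<beta>"] h_add h_sym cotangent_closed_add)
  have scale: "sharp A h p (\<lambda>v. c * \<alpha> v) = (\<lambda>f. c * sharp A h p \<alpha> f)" if "\<alpha> \<in> TsM p" for p \<alpha> c
    using that
    by (intro sharp(3) cotangent_closed_scale tangent_closed_scale sharp(1))
      (simp_all add: cotangent_scale sharp h_sym[of "\<lambda>v. c * \<alpha> v"] h_scale h_sym cotangent_closed_scale)
  have "on_sections (sharp A h) \<alpha> \<in> VF" if \<alpha>: "\<alpha> \<in> OF1" for \<alpha>
  proof (rule vector_fieldI)
    show "on_sections (sharp A h) \<alpha> p \<in> TM p" for p
      by (simp add: on_sections_def sharp(1) one_formD(1)[OF \<alpha>])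
    fix f assume f: "f \<in> C"
    have "(\<lambda>p. on_sections (sharp A h) \<alpha> p f) = biv h \<alpha> (differential f)"
    proof
      fix p
      have "differential f p \<in> TsM p" using differential(1)[OF f] one_formD(1) by blast
      from sharp(2)[OF one_formD(1)[OF \<alpha>] this] sharp(1)[OF one_formD(1)[OF \<alpha>, of p]]
      show "on_sections (sharp A h) \<alpha> p f = biv h \<alpha> (differential f) p"
        by (simp add: on_sections_def biv_def differential_def)
    qed
    then show "(\<lambda>p. on_sections (sharp A h) \<alpha> p f) \<in> C"
      using bivector \<alpha> differential(1)[OF f] by (simp add: symmetric_bivector_fields_def)
  qed
  then show ?thesis
    unfolding is_bundle_map_def using sharp(1) add scale by blast
qed

abbreviation sh :: "'a form \<Rightarrow> 'a vfield" where
  "sh \<equiv> on_sections (sharp A h)"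

lemma sh_VF: "\<alpha> \<in> OF1 \<Longrightarrow> sh \<alpha> \<in> VF"
  using sharp_bundle_map by (simp add: is_bundle_map_def)

lemma pair_sh: "\<alpha> \<in> OF1 \<Longrightarrow> \<beta> \<in> OF1 \<Longrightarrow> pair \<beta> (sh \<alpha>) = biv h \<alpha> \<beta>"
  by (simp add: pair_def biv_def on_sections_def sharp(2) one_formD(1))

lemma biv_sym: "\<alpha> \<in> OF1 \<Longrightarrow> \<beta> \<in> OF1 \<Longrightarrow> biv h \<alpha> \<beta> = biv h \<beta> \<alpha>"
  by (simp add: biv_def fun_eq_iff h_sym one_formD(1))

lemma pair_sh_sym: "\<alpha> \<in> OF1 \<Longrightarrow> \<beta> \<in> OF1 \<Longrightarrow> pair \<beta> (sh \<alpha>) = pair \<alpha> (sh \<beta>)"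
  by (simp add: pair_sh biv_sym)

lemma sh_add: "\<alpha> \<in> OF1 \<Longrightarrow> \<beta> \<in> OF1 \<Longrightarrow> sh (\<alpha> + \<beta>) = sh \<alpha> + sh \<beta>"
  using sharp_bundle_map by (simp add: is_bundle_map_def on_sections_def fun_eq_iff one_formD(1))

lemma sh_fmul: "\<alpha> \<in> OF1 \<Longrightarrow> sh (f \<odot> \<alpha>) = f \<odot> sh \<alpha>"
  using sharp_bundle_map by (simp add: is_bundle_map_def on_sections_def fun_eq_iff one_formD(1) fmul_def)

end

section \<open>Pseudo-Hessian bivector fields and Lie algebroids\<close>

context affine_bivector
begin

section \<open>Covariant differentiation of one-forms\<close>

lemmas smooth_closed = C_add C_diff C_mult act_smooth one_formD(2) VF_add VF_diff VF_fmul nabla_VF lie_VF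
  OF1_add OF1_diff OF1_fmul sh_VF

text \<open>Replacing \<open>Y\<close> by \<open>f \<odot> Y\<close> produces X(f)\<langle>\<alpha>,
  Y\<rangle> in both summands, and these cancel. So the prescription is linear over the smooth
  functions and \<open>form_of\<close> applies.\<close>

lemma cov_form:
  assumes X: "X \<in> VF" and \<alpha>: "\<alpha> \<in> OF1"
  shows cov_form_OF1: "cov_form A nabla X \<alpha> \<in> OF1"
    and pair_cov_form: "Y \<in> VF \<Longrightarrow>
      pair (cov_form A nabla X \<alpha>) Y = act X (pair \<alpha> Y) - pair \<alpha> (nabla X Y)"
proof -
  have "C_linear (\<lambda>Y. act X (pair \<alpha> Y) - pair \<alpha> (nabla X Y))"
    unfolding C_linear_def
    using X \<alpha>
    by (auto simp: pair_add pair_fmul nabla_add nabla_fmul act_add act_mult smooth_closed algebra_simps)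
  from form_of[OF this]
  show "cov_form A nabla X \<alpha> \<in> OF1" "Y \<in> VF \<Longrightarrow>
      pair (cov_form A nabla X \<alpha>) Y = act X (pair \<alpha> Y) - pair \<alpha> (nabla X Y)"
    unfolding cov_form_def using X \<alpha> by (auto simp: smooth_closed)
qed

abbreviation cov :: "'a vfield \<Rightarrow> 'a form \<Rightarrow> 'a form" where
  "cov \<equiv> cov_form A nabla"

lemma cov_add:
  assumes "X \<in> VF" "\<alpha> \<in> OF1" "\<beta> \<in> OF1"
  shows "cov X (\<alpha> + \<beta>) = cov X \<alpha> + cov X \<beta>"
  using assms
  by (intro one_form_eqI) (simp_all add: cov_form smooth_closed act_add)

lemma cov_diff:
  assumes "X \<in> VF" "\<alpha> \<in> OF1" "\<beta> \<in> OF1"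
  shows "cov X (\<alpha> - \<beta>) = cov X \<alpha> - cov X \<beta>"
  using assms
  by (intro one_form_eqI) (simp_all add: cov_form smooth_closed act_diff)

lemma cov_fmul:
  assumes "f \<in> C" "X \<in> VF" "\<alpha> \<in> OF1"
  shows "cov X (f \<odot> \<alpha>) = f \<odot> cov X \<alpha> + act X f \<odot> \<alpha>"
  using assms
  by (intro one_form_eqI) (simp_all add: cov_form smooth_closed act_mult algebra_simps)

lemma cov_add_left:
  assumes "X \<in> VF" "Y \<in> VF" "\<alpha> \<in> OF1"
  shows "cov (X + Y) \<alpha> = cov X \<alpha> + cov Y \<alpha>"
  using assms
  by (intro one_form_eqI) (simp_all add: cov_form smooth_closed nabla_add_left pair_add)

lemma cov_diff_left:
  assumes "X \<in> VF" "Y \<in> VF" "\<alpha> \<in> OF1"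
  shows "cov (X - Y) \<alpha> = cov X \<alpha> - cov Y \<alpha>"
  using cov_add_left[of "X - Y" Y \<alpha>] assms by (simp add: VF_diff)

lemma cov_fmul_left:
  assumes "f \<in> C" "X \<in> VF" "\<alpha> \<in> OF1"
  shows "cov (f \<odot> X) \<alpha> = f \<odot> cov X \<alpha>"
  using assms
  by (intro one_form_eqI) (simp_all add: cov_form smooth_closed nabla_fmul_left pair_fmul algebra_simps)

text \<open>Flatness passes to the dual: in the commutator of the two covariant derivatives the
  mixed terms cancel, leaving the commutator on functions and the curvature identity
  \<open>flat\<close> inside the pairing.\<close>

lemma cov_lie:
  assumes X: "X \<in> VF" and Y: "Y \<in> VF" and \<alpha>: "\<alpha> \<in> OF1"
  shows "cov (lie X Y) \<alpha> = cov X (cov Y \<alpha>) - cov Y (cov X \<alpha>)"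
  using assms
  by (intro one_form_eqI)
    (simp_all add: cov_form smooth_closed flat pair_diff act_diff algebra_simps)

section \<open>The covariant derivative of the bivector field\<close>

abbreviation Dh :: "'a vfield \<Rightarrow> 'a form \<Rightarrow> 'a form \<Rightarrow> 'a \<Rightarrow> real" where
  "Dh X \<equiv> cov_biv A nabla X h"

text \<open>The term X(h(\<alpha>, \<beta>)) cancels. Moving the anchor to the other form, what
  remains is \<langle>\<beta>, \<nabla>_X \<sharp>\<alpha> - \<sharp>\<nabla>_X \<alpha>\<rangle>,
  the failure of the anchor to be parallel. Linearity over functions can be read off from this
  form.\<close>

lemma Dh_eq:
  assumes "X \<in> VF" "\<alpha> \<in> OF1" "\<beta> \<in> OF1"
  shows "Dh X \<alpha> \<beta> = pair \<beta> (nabla X (sh \<alpha>)) - pair (cov X \<alpha>) (sh \<beta>)"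
proof -
  have "biv h \<alpha> (cov X \<beta>) = act X (pair \<beta> (sh \<alpha>)) - pair \<beta> (nabla X (sh \<alpha>))"
    using assms pair_sh[of \<alpha> "cov X \<beta>"] by (simp add: cov_form sh_VF)
  moreover have "biv h (cov X \<alpha>) \<beta> = pair (cov X \<alpha>) (sh \<beta>)"
    using assms by (simp add: pair_sh biv_sym cov_form)
  ultimately show ?thesis
    using assms by (simp add: cov_biv_def pair_sh)
qed

lemma Dh_sym:
  assumes "X \<in> VF" "\<alpha> \<in> OF1" "\<beta> \<in> OF1"
  shows "Dh X \<alpha> \<beta> = Dh X \<beta> \<alpha>"
  using assms by (simp add: cov_biv_def biv_sym[of \<alpha>] biv_sym[of "cov X \<alpha>"] cov_form)

lemma Dh_smooth: "X \<in> VF \<Longrightarrow> \<alpha> \<in> OF1 \<Longrightarrow> \<beta> \<in> OF1 \<Longrightarrow> Dh X \<alpha> \<beta> \<in> C"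
  by (simp add: Dh_eq cov_form smooth_closed)

lemma Dh_add_left: "X \<in> VF \<Longrightarrow> Y \<in> VF \<Longrightarrow> \<alpha> \<in> OF1 \<Longrightarrow> \<beta> \<in> OF1 \<Longrightarrow>
    Dh (X + Y) \<alpha> \<beta> = Dh X \<alpha> \<beta> + Dh Y \<alpha> \<beta>"
  by (simp add: Dh_eq smooth_closed nabla_add_left cov_add_left pair_add)

lemma Dh_fmul_left: "f \<in> C \<Longrightarrow> X \<in> VF \<Longrightarrow> \<alpha> \<in> OF1 \<Longrightarrow> \<beta> \<in> OF1 \<Longrightarrow>
    Dh (f \<odot> X) \<alpha> \<beta> = f * Dh X \<alpha> \<beta>"
  by (simp add: Dh_eq smooth_closed nabla_fmul_left cov_fmul_left pair_fmul algebra_simps)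

lemma Dh_add: "X \<in> VF \<Longrightarrow> \<alpha> \<in> OF1 \<Longrightarrow> \<beta> \<in> OF1 \<Longrightarrow> \<gamma> \<in> OF1 \<Longrightarrow>
    Dh X \<alpha> (\<beta> + \<gamma>) = Dh X \<alpha> \<beta> + Dh X \<alpha> \<gamma>"
  by (simp add: Dh_eq smooth_closed cov_form sh_add pair_add algebra_simps)

lemma Dh_fmul: "f \<in> C \<Longrightarrow> X \<in> VF \<Longrightarrow> \<alpha> \<in> OF1 \<Longrightarrow> \<beta> \<in> OF1 \<Longrightarrow>
    Dh X \<alpha> (f \<odot> \<beta>) = f * Dh X \<alpha> \<beta>"
  by (simp add: Dh_eq smooth_closed cov_form sh_fmul pair_fmul algebra_simps)

lemma Dh_add_middle: "X \<in> VF \<Longrightarrow> \<alpha> \<in> OF1 \<Longrightarrow> \<beta> \<in> OF1 \<Longrightarrow> \<gamma> \<in> OF1 \<Longrightarrow>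
    Dh X (\<alpha> + \<beta>) \<gamma> = Dh X \<alpha> \<gamma> + Dh X \<beta> \<gamma>"
  by (simp add: Dh_sym[of X _ \<gamma>] Dh_add OF1_add)

lemma Dh_fmul_middle: "f \<in> C \<Longrightarrow> X \<in> VF \<Longrightarrow> \<alpha> \<in> OF1 \<Longrightarrow> \<beta> \<in> OF1 \<Longrightarrow>
    Dh X (f \<odot> \<alpha>) \<beta> = f * Dh X \<alpha> \<beta>"
  by (simp add: Dh_sym[of X _ \<beta>] Dh_fmul OF1_fmul)

section \<open>The bracket and the defect of the anchor\<close>

abbreviation br :: "'a form \<Rightarrow> 'a form \<Rightarrow> 'a form" where
  "br \<equiv> h_bracket A nabla h"

lemma br_OF1: "\<alpha> \<in> OF1 \<Longrightarrow> \<beta> \<in> OF1 \<Longrightarrow> br \<alpha> \<beta> \<in> OF1"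
  by (simp add: h_bracket_def cov_form smooth_closed)

lemma br_fmul: "f \<in> C \<Longrightarrow> \<alpha> \<in> OF1 \<Longrightarrow> \<beta> \<in> OF1 \<Longrightarrow>
    br \<alpha> (f \<odot> \<beta>) = f \<odot> br \<alpha> \<beta> + act (sh \<alpha>) f \<odot> \<beta>"
  by (simp add: h_bracket_def sh_fmul cov_fmul cov_fmul_left sh_VF)
    (simp add: fun_eq_iff algebra_simps)

lemma br_antisym: "br \<alpha> \<beta> = - br \<beta> \<alpha>"
  by (simp add: h_bracket_def)

lemma br_add: "\<alpha> \<in> OF1 \<Longrightarrow> \<beta> \<in> OF1 \<Longrightarrow> \<gamma> \<in> OF1 \<Longrightarrow> br \<alpha> (\<beta> + \<gamma>) = br \<alpha> \<beta> + br \<alpha> \<gamma>"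
  by (simp add: h_bracket_def sh_add cov_add cov_add_left sh_VF)

lemma br_bilinear: "real_bilinear_map OF1 OF1 br"
proof -
  have 1: "br \<alpha> ((\<lambda>_. c) \<odot> \<beta>) = (\<lambda>_. c) \<odot> br \<alpha> \<beta>" if "\<alpha> \<in> OF1" "\<beta> \<in> OF1" for c \<alpha> \<beta>
    using that by (simp add: br_fmul smooth_funs_const act_const sh_VF) (simp add: fun_eq_iff)
  have 2: "br ((\<lambda>_. c) \<odot> \<alpha>) \<beta> = (\<lambda>_. c) \<odot> br \<alpha> \<beta>" if "\<alpha> \<in> OF1" "\<beta> \<in> OF1" for c \<alpha> \<beta>
    unfolding br_antisym[of _ \<beta>] 1[OF that(2,1)] by (simp add: fun_eq_iff)
  have 3: "br (\<alpha> + \<gamma>) \<beta> = br \<alpha> \<beta> + br \<gamma> \<beta>" if "\<alpha> \<in> OF1" "\<beta> \<in> OF1" "\<gamma> \<in> OF1" for \<alpha> \<beta> \<gamma>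
    unfolding br_antisym[of _ \<beta>] br_add[OF that(2,1,3)] by simp
  show ?thesis
    unfolding real_bilinear_map_def by (auto simp: br_OF1 br_add 1 2 3)
qed

text \<open>This is the field Z of the introduction, the failure of the anchor to preserve
  brackets.\<close>

definition defect :: "'a form \<Rightarrow> 'a form \<Rightarrow> 'a vfield" where
  "defect \<alpha> \<beta> = lie (sh \<alpha>) (sh \<beta>) - sh (br \<alpha> \<beta>)"

lemma defect_VF: "\<alpha> \<in> OF1 \<Longrightarrow> \<beta> \<in> OF1 \<Longrightarrow> defect \<alpha> \<beta> \<in> VF"
  by (simp add: defect_def smooth_closed br_OF1)

text \<open>Torsion-freeness expands the Lie bracket into two covariant derivatives, and symmetry of
  \<open>h\<close> moves the anchor from [\<alpha>, \<beta>] to \<gamma>. The four resulting terms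
  regroup in pairs by \<open>Dh_eq\<close>.\<close>

lemma pair_defect:
  assumes "\<alpha> \<in> OF1" "\<beta> \<in> OF1" "\<gamma> \<in> OF1"
  shows "pair \<gamma> (defect \<alpha> \<beta>) = Dh (sh \<alpha>) \<beta> \<gamma> - Dh (sh \<beta>) \<alpha> \<gamma>"
proof -
  have "pair \<gamma> (defect \<alpha> \<beta>) = pair \<gamma> (nabla (sh \<alpha>) (sh \<beta>)) - pair \<gamma> (nabla (sh \<beta>) (sh \<alpha>)) - pair (br \<alpha> \<beta>) (sh \<gamma>)"
    using assms
    by (simp add: defect_def pair_diff smooth_closed br_OF1 torsion pair_sh_sym[of "br \<alpha> \<beta>"])
  then show ?thesis
    using assms by (simp add: Dh_eq sh_VF h_bracket_def algebra_simps)
qed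

text \<open>The Leibniz terms of the two brackets in the defect cancel; by
  \<open>pair_defect\<close> this reduces to tensoriality of \<nabla>h.\<close>

lemma defect_fmul:
  assumes "f \<in> C" "\<alpha> \<in> OF1" "\<beta> \<in> OF1"
  shows "defect \<alpha> (f \<odot> \<beta>) = f \<odot> defect \<alpha> \<beta>" "defect (f \<odot> \<alpha>) \<beta> = f \<odot> defect \<alpha> \<beta>"
  using assms
  by (intro VF_eqI_pair; simp add: defect_VF smooth_closed pair_fmul pair_defect sh_fmul
      Dh_fmul_left Dh_fmul_middle algebra_simps)+

lemma pseudo_Hessian_iff: "pseudo_Hessian A nabla h \<longleftrightarrow> (\<forall>\<alpha>\<in>OF1. \<forall>\<beta>\<in>OF1. defect \<alpha> \<beta> = 0)"
proof -
  have "defect \<alpha> \<beta> = 0 \<longleftrightarrow> (\<forall>\<gamma>\<in>OF1. Dh (sh \<alpha>) \<beta> \<gamma> = Dh (sh \<beta>) \<alpha> \<gamma>)" if "\<alpha> \<in> OF1" "\<beta> \<in> OF1" for \<alpha> \<beta>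
  proof -
    have z: "pair \<gamma> 0 = 0" if "\<gamma> \<in> OF1" for \<gamma>
      using pair_diff[OF that VF_zero VF_zero] by simp
    have "defect \<alpha> \<beta> = 0 \<longleftrightarrow> (\<forall>\<gamma>\<in>OF1. pair \<gamma> (defect \<alpha> \<beta>) = 0)"
      using VF_eqI_pair[OF defect_VF[OF that] VF_zero] z by auto
    then show ?thesis using that by (simp add: pair_defect)
  qed
  then show ?thesis by (simp add: pseudo_Hessian_def)
qed

abbreviation jac :: "'a form \<Rightarrow> 'a form \<Rightarrow> 'a form \<Rightarrow> 'a form" where
  "jac \<alpha> \<beta> \<gamma> \<equiv> br \<alpha> (br \<beta> \<gamma>) + br \<beta> (br \<gamma> \<alpha>) + br \<gamma> (br \<alpha> \<beta>)"

lemma jac_eq: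
  assumes "\<alpha> \<in> OF1" "\<beta> \<in> OF1" "\<gamma> \<in> OF1"
  shows "jac \<alpha> \<beta> \<gamma> = cov (defect \<alpha> \<beta>) \<gamma> + cov (defect \<beta> \<gamma>) \<alpha> + cov (defect \<gamma> \<alpha>) \<beta>"
proof -
  have D: "cov (defect \<alpha> \<beta>) \<gamma> = cov (sh \<alpha>) (cov (sh \<beta>) \<gamma>) - cov (sh \<beta>) (cov (sh \<alpha>) \<gamma>) - cov (sh (br \<alpha> \<beta>)) \<gamma>"
    if "\<alpha> \<in> OF1" "\<beta> \<in> OF1" "\<gamma> \<in> OF1" for \<alpha> \<beta> \<gamma>
    using that by (simp add: defect_def cov_diff_left cov_lie smooth_closed br_OF1)
  \<comment> \<open>The inner bracket stays folded under the anchor, where it matches the last term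
    of \<open>D\<close> after a cyclic permutation. The second derivatives of the three Jacobi terms
    then regroup into the commutators of \<open>D\<close>.\<close>
  have B: "br \<alpha> (br \<beta> \<gamma>) = cov (sh \<alpha>) (cov (sh \<beta>) \<gamma>) - cov (sh \<alpha>) (cov (sh \<gamma>) \<beta>) - cov (sh (br \<beta> \<gamma>)) \<alpha>"
    if "\<alpha> \<in> OF1" "\<beta> \<in> OF1" "\<gamma> \<in> OF1" for \<alpha> \<beta> \<gamma>
    using that unfolding h_bracket_def[of A nabla h \<alpha>]
    by (simp add: h_bracket_def[of A nabla h \<beta> \<gamma>] cov_diff cov_form sh_VF)
  show ?thesis
    using assms by (simp add: D B)
qed

text \<open>The Jacobi identity for \<open>\<alpha>, \<beta>, f \<gamma>\<close> with \<open>\<gamma> = df\<close> leaves \<open>Z(f) df = 0\<close> for the defect \<open>Z\<close>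
  of the anchor, hence \<open>Z(f)\<^sup>2 = 0\<close>.\<close>

lemma defect_zero_if_jacobi:
  assumes jac: "\<And>\<alpha> \<beta> \<gamma>. \<alpha> \<in> OF1 \<Longrightarrow> \<beta> \<in> OF1 \<Longrightarrow> \<gamma> \<in> OF1 \<Longrightarrow> jac \<alpha> \<beta> \<gamma> = 0"
    and \<alpha>: "\<alpha> \<in> OF1" and \<beta>: "\<beta> \<in> OF1"
  shows "defect \<alpha> \<beta> = 0"
proof (rule VF_eqI[OF defect_VF[OF \<alpha> \<beta>] VF_zero])
  fix f assume f: "f \<in> C"
  let ?Z = "defect \<alpha> \<beta>"
  let ?\<gamma> = "differential f"
  note \<gamma> = differential[OF f]
  have Z: "?Z \<in> VF" by (rule defect_VF[OF \<alpha> \<beta>])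
  \<comment> \<open>By \<open>defect_fmul\<close> the two terms whose defect contains
    \<open>f \<odot> ?\<gamma>\<close> merely scale with \<open>f\<close>; only differentiating
    \<open>f \<odot> ?\<gamma>\<close> along \<open>?Z\<close> yields a new term.\<close>
  have "jac \<alpha> \<beta> (f \<odot> ?\<gamma>) = f \<odot> (cov ?Z ?\<gamma> + cov (defect \<beta> ?\<gamma>) \<alpha> + cov (defect ?\<gamma> \<alpha>) \<beta>) + act ?Z f \<odot> ?\<gamma>"
    using f \<alpha> \<beta> \<gamma>(1)
    by (simp add: jac_eq OF1_fmul defect_fmul cov_fmul cov_fmul_left defect_VF)
      (simp add: fun_eq_iff algebra_simps)
  also have "\<dots> = f \<odot> jac \<alpha> \<beta> ?\<gamma> + act ?Z f \<odot> ?\<gamma>"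
    by (simp only: jac_eq[OF \<alpha> \<beta> \<gamma>(1)])
  finally have "act ?Z f \<odot> ?\<gamma> = 0"
    using jac[OF \<alpha> \<beta> \<gamma>(1)] jac[OF \<alpha> \<beta> OF1_fmul[OF f \<gamma>(1)]] by (simp add: fun_eq_iff)
  then have "pair (act ?Z f \<odot> ?\<gamma>) ?Z = 0" by simp
  then have "act ?Z f * act ?Z f = 0" using \<gamma>(2)[OF Z] by simp
  then show "act ?Z f = act 0 f"
    by (simp add: fun_eq_iff act_def)
qed

lemma pseudo_Hessian_iff_algebroid:
  "pseudo_Hessian A nabla h \<longleftrightarrow> is_cotangent_Lie_algebroid A (sharp A h) br"
proof
  assume "pseudo_Hessian A nabla h"
  then have "defect \<alpha> \<beta> = 0" if "\<alpha> \<in> OF1" "\<beta> \<in> OF1" for \<alpha> \<beta>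
    using that by (simp add: pseudo_Hessian_iff)
  moreover have "cov 0 \<alpha> = 0" if "\<alpha> \<in> OF1" for \<alpha>
    using cov_diff_left[OF VF_zero VF_zero that] by simp
  ultimately have "jac \<alpha> \<beta> \<gamma> = 0" if "\<alpha> \<in> OF1" "\<beta> \<in> OF1" "\<gamma> \<in> OF1" for \<alpha> \<beta> \<gamma>
    using that by (simp add: jac_eq)
  then show "is_cotangent_Lie_algebroid A (sharp A h) br"
    unfolding is_cotangent_Lie_algebroid_def
    by (intro conjI ballI sharp_bundle_map br_bilinear br_antisym br_fmul)
next
  assume "is_cotangent_Lie_algebroid A (sharp A h) br"
  then have "jac \<alpha> \<beta> \<gamma> = 0" if "\<alpha> \<in> OF1" "\<beta> \<in> OF1" "\<gamma> \<in> OF1" for \<alpha> \<beta> \<gamma>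
    using that unfolding is_cotangent_Lie_algebroid_def by blast
  then show "pseudo_Hessian A nabla h"
    unfolding pseudo_Hessian_iff using defect_zero_if_jacobi by blast
qed

section \<open>The algebroid connection and its curvature\<close>

abbreviation D :: "'a form \<Rightarrow> 'a form \<Rightarrow> 'a form" where
  "D \<equiv> h_connection A nabla h"

lemma D:
  assumes "\<alpha> \<in> OF1" "\<beta> \<in> OF1"
  shows D_OF1: "D \<alpha> \<beta> \<in> OF1"
    and pair_D: "X \<in> VF \<Longrightarrow> pair (D \<alpha> \<beta>) X = Dh X \<alpha> \<beta> + pair (cov (sh \<alpha>) \<beta>) X"
proof -
  have "C_linear (\<lambda>X. Dh X \<alpha> \<beta> + pair (cov (sh \<alpha>) \<beta>) X)"
    unfolding C_linear_def
    using assms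
    by (auto simp: Dh_add_left Dh_fmul_left pair_add[OF cov_form_OF1] pair_fmul[OF cov_form_OF1] sh_VF algebra_simps)
  from form_of[OF this]
  show "D \<alpha> \<beta> \<in> OF1" "X \<in> VF \<Longrightarrow> pair (D \<alpha> \<beta>) X = Dh X \<alpha> \<beta> + pair (cov (sh \<alpha>) \<beta>) X"
    unfolding h_connection_def using assms
    by (auto simp: C_add Dh_smooth one_formD(2)[OF cov_form_OF1] sh_VF)
qed

text \<open>The \<nabla>h summand is linear over functions in both forms, so the derivative term in
  the Leibniz rule comes from \<nabla> along the anchor alone.\<close>

lemma D_connection: "is_algebroid_connection A (sharp A h) D"
proof -
  have 1: "D (\<alpha> + \<beta>) \<gamma> = D \<alpha> \<gamma> + D \<beta> \<gamma>" "D \<gamma> (\<alpha> + \<beta>) = D \<gamma> \<alpha> + D \<gamma> \<beta>"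
    if "\<alpha> \<in> OF1" "\<beta> \<in> OF1" "\<gamma> \<in> OF1" for \<alpha> \<beta> \<gamma>
    using that
    by (intro one_form_eqI; simp add: D OF1_add Dh_add Dh_add_middle sh_add sh_VF cov_add cov_add_left)+
  have 2: "D (f \<odot> \<alpha>) \<beta> = f \<odot> D \<alpha> \<beta>" "D \<alpha> (f \<odot> \<beta>) = f \<odot> D \<alpha> \<beta> + act (sh \<alpha>) f \<odot> \<beta>"
    if "f \<in> C" "\<alpha> \<in> OF1" "\<beta> \<in> OF1" for f \<alpha> \<beta>
    using that
    by (intro one_form_eqI; simp add: D smooth_closed Dh_fmul Dh_fmul_middle sh_fmul cov_fmul cov_fmul_left algebra_simps)+
  have 3: "D ((\<lambda>_. c) \<odot> \<alpha>) \<beta> = (\<lambda>_. c) \<odot> D \<alpha> \<beta>" "D \<alpha> ((\<lambda>_. c) \<odot> \<beta>) = (\<lambda>_. c) \<odot> D \<alpha> \<beta>"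
    if "\<alpha> \<in> OF1" "\<beta> \<in> OF1" for c \<alpha> \<beta>
    using 2[OF smooth_funs_const[of c] that] act_const[OF sh_VF[OF that(1)]]
    by (simp_all add: fun_eq_iff)
  show ?thesis
    unfolding is_algebroid_connection_def real_bilinear_map_def by (auto simp: D_OF1 1 2 3)
qed

text \<open>Pairing with \<gamma> moves the anchor onto \<gamma>, and (\<nabla>h)(\<alpha>, \<beta>)
  along \<sharp>\<gamma> appears. The pseudo-Hessian condition and symmetry turn it into
  (\<nabla>h)(\<beta>, \<gamma>) along \<sharp>\<alpha>, whose second term in \<open>Dh_eq\<close>
  cancels the remaining summand of \<open>D\<close>.\<close>

lemma sh_D:
  assumes pH: "pseudo_Hessian A nabla h" and \<alpha>: "\<alpha> \<in> OF1" and \<beta>: "\<beta> \<in> OF1"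
  shows "sh (D \<alpha> \<beta>) = nabla (sh \<alpha>) (sh \<beta>)"
proof (rule VF_eqI_pair)
  fix \<gamma> assume \<gamma>: "\<gamma> \<in> OF1"
  have "Dh (sh \<gamma>) \<alpha> \<beta> = Dh (sh \<alpha>) \<gamma> \<beta>"
    using pH \<alpha> \<beta> \<gamma> by (simp add: pseudo_Hessian_def)
  also have "\<dots> = Dh (sh \<alpha>) \<beta> \<gamma>"
    using \<alpha> \<beta> \<gamma> by (simp add: Dh_sym sh_VF)
  finally show "pair \<gamma> (sh (D \<alpha> \<beta>)) = pair \<gamma> (nabla (sh \<alpha>) (sh \<beta>))"
    using \<alpha> \<beta> \<gamma> pair_sh_sym[OF D_OF1[OF \<alpha> \<beta>] \<gamma>]
    by (simp add: pair_D sh_VF Dh_eq)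
qed (use \<alpha> \<beta> in \<open>auto simp: smooth_closed D_OF1\<close>)

text \<open>Vanishing torsion merges \<langle>\<beta>, \<nabla>_X \<sharp>\<alpha>\<rangle> from
  \<open>Dh_eq\<close> with the term -\<langle>\<beta>, \<nabla> X\<rangle> along \<sharp>\<alpha>
  from \<open>cov_form\<close> into a Lie bracket.\<close>

lemma pair_D_lie:
  assumes "\<alpha> \<in> OF1" "\<beta> \<in> OF1" "X \<in> VF"
  shows "pair (D \<alpha> \<beta>) X = act (sh \<alpha>) (pair \<beta> X) - pair \<beta> (lie (sh \<alpha>) X) - pair (cov X \<alpha>) (sh \<beta>)"
  using assms by (simp add: pair_D Dh_eq cov_form smooth_closed torsion pair_diff)

lemma lie_jacobi:
  assumes "X \<in> VF" "Y \<in> VF" "Z \<in> VF"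
  shows "lie (lie X Y) Z = lie X (lie Y Z) - lie Y (lie X Z)"
  using assms by (intro VF_eqI) (simp_all add: smooth_closed act_diff algebra_simps)

lemma D_flat:
  assumes pH: "pseudo_Hessian A nabla h" and \<alpha>: "\<alpha> \<in> OF1" and \<beta>: "\<beta> \<in> OF1" and \<gamma>: "\<gamma> \<in> OF1"
  shows "algebroid_curvature br D \<alpha> \<beta> \<gamma> = 0"
proof (rule one_form_eqI[OF _ OF1_zero])
  show "algebroid_curvature br D \<alpha> \<beta> \<gamma> \<in> OF1"
    using \<alpha> \<beta> \<gamma> by (simp add: algebroid_curvature_def OF1_add OF1_diff D_OF1 br_OF1)
  fix X assume X: "X \<in> VF"
  \<comment> \<open>\<open>pair_D_lie\<close> is applied once to the outer connection and again to
    \<open>D \<beta> \<gamma>\<close> paired with \<open>X\<close> and with the bracket of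
    \<sharp>\<alpha> and \<open>X\<close>; the remaining occurrence, under the anchor, is resolved
    by \<open>sh_D\<close>.\<close>
  have twice: "pair (D \<alpha> (D \<beta> \<gamma>)) X =
      act (sh \<alpha>) (act (sh \<beta>) (pair \<gamma> X)) - act (sh \<alpha>) (pair \<gamma> (lie (sh \<beta>) X)) - act (sh \<alpha>) (pair (cov X \<beta>) (sh \<gamma>))
      - act (sh \<beta>) (pair \<gamma> (lie (sh \<alpha>) X)) + pair \<gamma> (lie (sh \<beta>) (lie (sh \<alpha>) X))
      + pair (cov (lie (sh \<alpha>) X) \<beta>) (sh \<gamma>) - pair (cov X \<alpha>) (nabla (sh \<beta>) (sh \<gamma>))"
    if "\<alpha> \<in> OF1" "\<beta> \<in> OF1" for \<alpha> \<beta>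
    using that \<gamma> X
    by (simp add: pair_D_lie D_OF1 smooth_closed sh_D[OF pH] act_diff act_add cov_form algebra_simps)
  have "lie (sh \<alpha>) (sh \<beta>) = sh (br \<alpha> \<beta>)"
    using pH \<alpha> \<beta> by (simp add: pseudo_Hessian_iff defect_def)
  then have "pair (D (br \<alpha> \<beta>) \<gamma>) X = act (lie (sh \<alpha>) (sh \<beta>)) (pair \<gamma> X)
      - pair \<gamma> (lie (lie (sh \<alpha>) (sh \<beta>)) X) - pair (cov X (br \<alpha> \<beta>)) (sh \<gamma>)"
    using \<alpha> \<beta> \<gamma> X by (simp add: pair_D_lie br_OF1 del: act_lie)
  moreover have "cov X (br \<alpha> \<beta>) = cov X (cov (sh \<alpha>) \<beta>) - cov X (cov (sh \<beta>) \<alpha>)"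
    using \<alpha> \<beta> X by (simp add: h_bracket_def cov_diff cov_form sh_VF)
  \<comment> \<open>Terms acting on \<langle>\<gamma>, X\<rangle> cancel as commutators, iterated
    Lie brackets by \<open>lie_jacobi\<close>. The derivative of \<beta> along the bracket of
    \<sharp>\<alpha> and \<open>X\<close> splits by flatness: one half cancels against \<nabla>_X of
    the bracket of forms, the other against the remaining terms in \<nabla>_X \<beta> by the product
    rule \<open>pair_cov_form\<close>. The terms in \<alpha> behave likewise.\<close>
  ultimately show "pair (algebroid_curvature br D \<alpha> \<beta> \<gamma>) X = pair 0 X"
    using \<alpha> \<beta> \<gamma> X
    by (simp add: algebroid_curvature_def twice lie_jacobi smooth_closed pair_diff cov_lie cov_form algebra_simps)
qed

end

theorem theorem2p4:
  fixes A :: "('a::{t2_space, second_countable_topology}, 'e::euclidean_space) chart set"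
    and nabla :: "'a vfield \<Rightarrow> 'a vfield \<Rightarrow> 'a vfield"
    and h :: "'a bivector"
  assumes "affine_manifold A nabla"
    and "h \<in> symmetric_bivector_fields A"
  shows "(pseudo_Hessian A nabla h \<longleftrightarrow>
            is_cotangent_Lie_algebroid A (sharp A h) (h_bracket A nabla h)) \<and>
         (pseudo_Hessian A nabla h \<longrightarrow>
            is_algebroid_connection A (sharp A h) (h_connection A nabla h) \<and>
            (\<forall>\<alpha>\<in>one_forms A. \<forall>\<beta>\<in>one_forms A.
               on_sections (sharp A h) (h_connection A nabla h \<alpha> \<beta>) =
               nabla (on_sections (sharp A h) \<alpha>) (on_sections (sharp A h) \<beta>)) \<and>
            (\<forall>\<alpha>\<in>one_forms A. \<forall>\<beta>\<in>one_forms A. \<forall>\<gamma>\<in>one_forms A.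
               algebroid_curvature (h_bracket A nabla h) (h_connection A nabla h) \<alpha> \<beta> \<gamma> = 0))"
proof -
  interpret affine_bivector A nabla h
    using assms by unfold_locales
  show ?thesis
    using pseudo_Hessian_iff_algebroid D_connection sh_D D_flat by blast
qed

end
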